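(* Let $n\geq1$ be an integer, $s\geq0$ and $\tau_1>0$ real, and $\tau_2:=\frac{\tau_1^2}{4}-\frac{\tau_1}{2}$. Let $v$ be the solution of $$v_{tt}-\Delta v+\frac{\tau_1}{1+t}v_t+\frac{\tau_2}{(1+t)^2}v=0\ \text{ in }(0,\infty)\times\mathbb{R}^n,\qquad (v,v_t)(0,\cdot)=(v_0,v_1),$$ and put $g:=\frac{\tau_1}{2}v_0+v_1$. For $n>2s$ let $D(t):=t^{1+s-\frac n2}$ if $n<2+2s$, $D(t):=\sqrt{\ln t}$ if $n=2+2s$, and $D(t):=1$ if $n>2+2s$. (i) If $n>2s$, there are $C,T>0$ depending only on $n,s,\tau_1$ such that whenever $v_0\in L^2$ and $\nabla^s v_0,\nabla^s v_1\in L^2\cap L^1$, $$\|v(t,\cdot)\|_{L^2}\leq C\,t^{-\frac{\tau_1}{2}}D(t)\big(\|v_0\|_{L^2}+\|\nabla^s v_0\|_{L^2\cap L^1}+\|\nabla^s v_1\|_{L^2\cap L^1}\big)\quad\text{for } t\geq T.$$ (ii) If $n>2s$, $v_0\in L^2\cap L^1$, $\nabla^s v_0,\nabla^s v_1\in L^2\cap L^1$, $\nabla^s g\in L^{1,1}$ and $P_{\nabla^s g}\neq0$, then there are $c,T>0$ independent of $t$ (possibly depending on the data) such that $\|v(t,\cdot)\|_{L^2}\geq c\,t^{-\frac{\tau_1}{2}}D(t)\,|P_{\nabla^s g}|$ for $t\geq T$. (iii) If $n\leq 2s$, $v_0\in L^2$, $\nabla^s g\in L^{1,1}$ and $P_{\nabla^s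 g}\neq0$, then $\|v(t,\cdot)\|_{L^2}=+\infty$ for all $t\in(0,t_0]$, for every $t_0>0$.
   Context: All function spaces are over $\mathbb{R}^n$; $\hat f$ is the Fourier transform. $L^{1,1}:=\{f\in L^1:\|(1+|x|)f\|_{L^1}<\infty\}$; $\|f\|_{X\cap Y}=\|f\|_X+\|f\|_Y$; $P_f:=\int_{\mathbb{R}^n}f\,dx$. For real $s\geq0$, $\nabla^s$ is the Fourier multiplier with symbol $|\xi|^s$: "$\nabla^s f\in X$" means that $\hat f$ is a measurable function such that $|\xi|^s\hat f(\xi)$ is the Fourier transform of a function in $X$, denoted $\nabla^s f$. The solution is understood as the one given in Fourier space by $\hat v(t,\xi)=(1+t)^{-\frac{\tau_1}{2}}\Big(\cos(|\xi|t)\,\hat v_0(\xi)+\frac{\sin(|\xi|t)}{|\xi|}\hat g(\xi)\Big)$, and $\|v(t,\cdot)\|_{L^2}\in[0,+\infty]$ is computed by Plancherel. *)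

theory Defs
  imports "HOL-Analysis.Analysis"
begin

definition norm_L1 :: "('a::euclidean_space \<Rightarrow> complex) \<Rightarrow> ennreal" where
  "norm_L1 f = (\<integral>\<^sup>+ x. ennreal (cmod (f x)) \<partial>lebesgue)"

definition norm_L2 :: "('a::euclidean_space \<Rightarrow> complex) \<Rightarrow> ennreal" where
  "norm_L2 f = (let I = \<integral>\<^sup>+ x. ennreal ((cmod (f x))\<^sup>2) \<partial>lebesgue
                in if I = \<infinity> then \<infinity> else ennreal (sqrt (enn2real I)))"

definition norm_L2_L1 :: "('a::euclidean_space \<Rightarrow> complex) \<Rightarrow> ennreal" where
  "norm_L2_L1 f = norm_L2 f + norm_L1 f"

definition L1 :: "('a::euclidean_space \<Rightarrow> complex) set" where
  "L1 = {f \<in> borel_measurable lebesgue. norm_L1 f < \<infinity>}"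

definition L2 :: "('a::euclidean_space \<Rightarrow> complex) set" where
  "L2 = {f \<in> borel_measurable lebesgue. norm_L2 f < \<infinity>}"

definition L11 :: "('a::euclidean_space \<Rightarrow> complex) set" where
  "L11 = {f \<in> L1. norm_L1 (\<lambda>x. of_real (1 + norm x) * f x) < \<infinity>}"

definition total_mass :: "('a::euclidean_space \<Rightarrow> complex) \<Rightarrow> complex" where
  "total_mass f = (LINT x|lebesgue. f x)"

text \<open>The Fourier transform is normalised to be unitary on \<open>L2\<close>, so that by Plancherel a function
  and its transform have the same \<open>L2\<close> norm.\<close>

definition fourier_integral :: "('a::euclidean_space \<Rightarrow> complex) \<Rightarrow> 'a \<Rightarrow> complex" where
  "fourier_integral f \<xi> =
     of_real ((2 * pi) powr (- real DIM('a) / 2)) *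
     (LINT x|lebesgue. exp (- \<i> * of_real (x \<bullet> \<xi>)) * f x)"

text \<open>\<open>fourier_transform f F\<close> says that \<open>F\<close> is a version of the Fourier transform of \<open>f\<close>: the
  integral for \<open>f\<close> in \<open>L1\<close>, and otherwise its extension to \<open>L2\<close>, i.e. the \<open>L2\<close> limit of the
  transforms of the truncations of \<open>f\<close> to balls.  (For \<open>f\<close> in both spaces the two agree almost
  everywhere.)\<close>

definition fourier_transform ::
    "('a::euclidean_space \<Rightarrow> complex) \<Rightarrow> ('a \<Rightarrow> complex) \<Rightarrow> bool" where
  "fourier_transform f F \<longleftrightarrow> F \<in> borel_measurable lebesgue \<and>
     (if f \<in> L1 then AE \<xi> in lebesgue. F \<xi> = fourier_integral f \<xi>
      else f \<in> L2 \<and>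
        ((\<lambda>R. norm_L2 (\<lambda>\<xi>. F \<xi> - fourier_integral (\<lambda>x. indicator (ball 0 R) x * f x) \<xi>))
           \<longlongrightarrow> 0) at_top)"

text \<open>\<open>fractional_gradient s F h\<close> says that \<open>\<nabla>\<^sup>s f = h\<close>, where \<open>f\<close> is the (generalised) function
  whose Fourier transform is the measurable function \<open>F\<close>.  The argument is \<open>F\<close> and not \<open>f\<close>
  because \<open>f\<close> itself need not be an \<open>L1\<close> or \<open>L2\<close> function, and for \<open>DIM('a) \<le> s\<close> the function \<open>F\<close>
  need not even be locally integrable.  The value \<open>0 powr 0 = 0\<close> only affects the null set
  \<open>{0}\<close>.\<close>

definition fractional_gradient ::
    "real \<Rightarrow> ('a::euclidean_space \<Rightarrow> complex) \<Rightarrow> ('a \<Rightarrow> complex) \<Rightarrow> bool" where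
  "fractional_gradient s F h \<longleftrightarrow> F \<in> borel_measurable lebesgue \<and>
     fourier_transform h (\<lambda>\<xi>. of_real (norm \<xi> powr s) * F \<xi>)"

text \<open>In the following, \<open>F0\<close> and \<open>F1\<close> are the Fourier transforms of the initial position
  \<open>v\<^sub>0\<close> and the initial velocity \<open>v\<^sub>1\<close>.\<close>

definition g_hat ::
    "real \<Rightarrow> ('a \<Rightarrow> complex) \<Rightarrow> ('a \<Rightarrow> complex) \<Rightarrow> 'a \<Rightarrow> complex" where
  "g_hat \<tau>1 F0 F1 \<xi> = of_real (\<tau>1 / 2) * F0 \<xi> + F1 \<xi>"

definition v_hat :: "real \<Rightarrow> ('a::euclidean_space \<Rightarrow> complex) \<Rightarrow> ('a \<Rightarrow> complex) \<Rightarrow>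
    real \<Rightarrow> 'a \<Rightarrow> complex" where
  "v_hat \<tau>1 F0 F1 t \<xi> =
     of_real ((1 + t) powr (- \<tau>1 / 2)) *
     (of_real (cos (norm \<xi> * t)) * F0 \<xi> +
      of_real (sin (norm \<xi> * t) / norm \<xi>) * g_hat \<tau>1 F0 F1 \<xi>)"

text \<open>\<open>v_hat\<close> solves the Fourier transformed Cauchy problem for
  \<open>v\<^sub>t\<^sub>t - \<Delta>v + \<tau>1/(1+t) v\<^sub>t + \<tau>2/(1+t)\<^sup>2 v = 0\<close>; this is where the value of \<open>\<tau>2\<close> enters.\<close>

lemma v_hat_solves:
  fixes \<xi> :: "'a::euclidean_space" and \<tau>1 \<tau>2 :: real
  assumes "\<xi> \<noteq> 0" and \<tau>2: "\<tau>2 = \<tau>1\<^sup>2 / 4 - \<tau>1 / 2"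
  shows "v_hat \<tau>1 F0 F1 0 \<xi> = F0 \<xi>"
    and "\<exists>v' v''. v' 0 = F1 \<xi> \<and> (\<forall>t\<ge>0.
          ((\<lambda>t. v_hat \<tau>1 F0 F1 t \<xi>) has_vector_derivative v' t) (at t) \<and>
          (v' has_vector_derivative v'' t) (at t) \<and>
          v'' t + of_real ((norm \<xi>)\<^sup>2) * v_hat \<tau>1 F0 F1 t \<xi>
            + of_real (\<tau>1 / (1 + t)) * v' t
            + of_real (\<tau>2 / (1 + t)\<^sup>2) * v_hat \<tau>1 F0 F1 t \<xi> = 0)"
proof -
  show "v_hat \<tau>1 F0 F1 0 \<xi> = F0 \<xi>" by (simp add: v_hat_def)
  define r where "r = norm \<xi>"
  have r: "r > 0" using assms by (simp add: r_def)
  define p where "p k t = (1 + t) powr (- \<tau>1 / 2 - k)" for k t :: real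
  define A where "A = F0 \<xi>"
  define B where "B = g_hat \<tau>1 F0 F1 \<xi>"
  define w where "w t = of_real (cos (r * t)) * A + of_real (sin (r * t) / r) * B" for t
  define w' where "w' t = of_real (cos (r * t)) * B - of_real (r * sin (r * t)) * A" for t
  define v' where "v' t = of_real (p 0 t) * w' t - of_real (\<tau>1 / 2 * p 1 t) * w t" for t
  define v'' where "v'' t = - of_real (p 0 t * r\<^sup>2) * w t - of_real (\<tau>1 * p 1 t) * w' t
     + of_real (\<tau>1 / 2 * (\<tau>1 / 2 + 1) * p 2 t) * w t" for t
  have v: "v_hat \<tau>1 F0 F1 t \<xi> = of_real (p 0 t) * w t" for t
    by (simp add: v_hat_def p_def w_def A_def B_def r_def)
  have dp: "(p k has_real_derivative (- \<tau>1 / 2 - k) * p (k + 1) t) (at t)" if "t \<ge> 0" for k t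
    unfolding p_def using that by (auto intro!: derivative_eq_intros simp: algebra_simps)
  have dp': "((\<lambda>t. complex_of_real (p k t)) has_vector_derivative
      of_real ((- \<tau>1 / 2 - k) * p (k + 1) t)) (at t)" if "t \<ge> 0" for k t
    by (rule has_vector_derivative_of_real[OF dp[OF that]])
  have dw: "(w has_vector_derivative w' t) (at t)" for t
  proof -
    have 1: "((\<lambda>t. complex_of_real (cos (r * t))) has_vector_derivative of_real (- r * sin (r * t))) (at t)"
      by (rule has_vector_derivative_of_real) (auto intro!: derivative_eq_intros)
    have 2: "((\<lambda>t. complex_of_real (sin (r * t) / r)) has_vector_derivative of_real (cos (r * t))) (at t)"
      by (rule has_vector_derivative_of_real) (use r in \<open>auto intro!: derivative_eq_intros\<close>)
    show ?thesis unfolding w_def w'_def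
      by (rule has_vector_derivative_eq_rhs[OF has_vector_derivative_add
            [OF has_vector_derivative_mult_left[OF 1] has_vector_derivative_mult_left[OF 2]]]) simp
  qed
  have dw': "(w' has_vector_derivative - of_real (r\<^sup>2) * w t) (at t)" for t
  proof -
    have 1: "((\<lambda>t. complex_of_real (cos (r * t))) has_vector_derivative of_real (- r * sin (r * t))) (at t)"
      by (rule has_vector_derivative_of_real) (auto intro!: derivative_eq_intros)
    have 2: "((\<lambda>t. complex_of_real (r * sin (r * t))) has_vector_derivative of_real (r\<^sup>2 * cos (r * t))) (at t)"
      by (rule has_vector_derivative_of_real)
         (auto intro!: derivative_eq_intros simp: power2_eq_square)
    show ?thesis unfolding w_def w'_def
      by (rule has_vector_derivative_eq_rhs[OF has_vector_derivative_diff
            [OF has_vector_derivative_mult_left[OF 1] has_vector_derivative_mult_left[OF 2]]])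
         (use r in \<open>simp add: field_simps power2_eq_square\<close>)
  qed
  have dv: "((\<lambda>t. v_hat \<tau>1 F0 F1 t \<xi>) has_vector_derivative v' t) (at t)" if "t \<ge> 0" for t
    unfolding v v'_def
    by (rule has_vector_derivative_eq_rhs[OF has_vector_derivative_mult[OF dp'[OF that] dw]]) simp
  have dv': "(v' has_vector_derivative v'' t) (at t)" if "t \<ge> 0" for t
  proof -
    have 1: "((\<lambda>t. complex_of_real (\<tau>1 / 2 * p 1 t)) has_vector_derivative
        of_real (\<tau>1 / 2 * ((- \<tau>1 / 2 - 1) * p 2 t))) (at t)"
      using has_vector_derivative_mult_right[OF dp'[OF that, of 1], of "of_real (\<tau>1 / 2)"] by simp
    show ?thesis unfolding v'_def[abs_def] v''_def
      by (rule has_vector_derivative_eq_rhs[OF has_vector_derivative_diff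
            [OF has_vector_derivative_mult[OF dp'[OF that] dw'] has_vector_derivative_mult[OF 1 dw]]])
         (simp add: algebra_simps)
  qed
  have p1: "p 1 t = p 0 t / (1 + t)" and p2: "p 2 t = p 0 t / (1 + t)\<^sup>2" if "t \<ge> 0" for t
    using that by (simp_all add: p_def powr_diff)
  have eq: "v'' t + of_real (r\<^sup>2) * (of_real (p 0 t) * w t) + of_real (\<tau>1 / (1 + t)) * v' t
            + of_real (\<tau>2 / (1 + t)\<^sup>2) * (of_real (p 0 t) * w t) = 0" if "t \<ge> 0" for t
  proof -
    define q where "q = 1 / (1 + t)"
    have q: "p 1 t = p 0 t * q" "p 2 t = p 0 t * q\<^sup>2" "\<tau>1 / (1 + t) = \<tau>1 * q" "\<tau>2 / (1 + t)\<^sup>2 = \<tau>2 * q\<^sup>2"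
      using that by (simp_all add: p1 p2 q_def power_divide)
    show ?thesis unfolding v''_def v'_def q unfolding \<tau>2
      by (simp add: field_simps power2_eq_square)
  qed
  have "v' 0 = F1 \<xi>"
    using r by (simp add: v'_def w'_def w_def p_def B_def A_def g_hat_def)
  with dv dv' eq show "\<exists>v' v''. v' 0 = F1 \<xi> \<and> (\<forall>t\<ge>0.
          ((\<lambda>t. v_hat \<tau>1 F0 F1 t \<xi>) has_vector_derivative v' t) (at t) \<and>
          (v' has_vector_derivative v'' t) (at t) \<and>
          v'' t + of_real ((norm \<xi>)\<^sup>2) * v_hat \<tau>1 F0 F1 t \<xi>
            + of_real (\<tau>1 / (1 + t)) * v' t
            + of_real (\<tau>2 / (1 + t)\<^sup>2) * v_hat \<tau>1 F0 F1 t \<xi> = 0)"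
    unfolding v r_def[symmetric] by blast
qed

definition norm_v :: "real \<Rightarrow> ('a::euclidean_space \<Rightarrow> complex) \<Rightarrow> ('a \<Rightarrow> complex) \<Rightarrow>
    real \<Rightarrow> ennreal" where
  "norm_v \<tau>1 F0 F1 t = norm_L2 (v_hat \<tau>1 F0 F1 t)"

definition D :: "nat \<Rightarrow> real \<Rightarrow> real \<Rightarrow> real" where
  "D n s t = (if real n < 2 + 2 * s then t powr (1 + s - real n / 2)
              else if real n = 2 + 2 * s then sqrt (ln t)
              else 1)"

end

theory Submission
  imports Defs "HOL-Probability.Characteristic_Functions"
begin

text \<open>In Fourier space the estimates reduce to the integral of \<open>sin\<^sup>2(|\<xi>| t) |\<xi>|\<^bsup>-2-2s\<^esup>\<close> over a
  ball.  In polar coordinates it is a one-dimensional integral of size \<open>D(t)\<^sup>2\<close>, and it is infinite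
  when \<open>n \<le> 2s\<close>.  From above, the transform of \<open>\<nabla>\<^sup>s g\<close> is bounded by the \<open>L1\<close> norm near the origin
  and controlled in \<open>L2\<close> elsewhere; from below, it is continuous at the origin with value
  proportional to \<open>P\<close>, hence bounded away from zero on a small ball.  The term
  \<open>cos(|\<xi>| t) v\<^sub>0\<close> is of lower order: it contributes at most a constant times the volume of the
  ball if \<open>v\<^sub>0\<close> is in \<open>L1\<close>, and has finite energy if \<open>v\<^sub>0\<close> is in \<open>L2\<close>.
  Plancherel is only needed as an inequality; it follows by inserting a Gaussian weight, applying
  Fubini and using that the Fourier transform of a Gaussian is positive with constant integral.\<close>

section \<open>Gaussians and their Fourier transforms\<close>

text \<open>One exponent governs everything: q = n - 2 - 2s. In polar coordinates the weight becomes
  r^(q-1); the condition n > 2s reads q > -2, which is exactly integrability of (r t)^2 r^(q-1) at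
  the origin; and the three cases of D are the three signs of q. The Gaussian weight answers an
  obstacle: the transform U of an L1 function is merely bounded, |U|^2 is not known to be
  integrable, and the order of integration cannot be exchanged. With the weight it can, the
  resulting bound does not depend on the width, and monotone convergence removes the weight. The
  delicate lower bound is the case q > 0. There D = 1, so waiting does not make the main term
  outgrow the cosine term; the two have to be compared through the size of the ball, which requires
  a lower bound for the mass whose constant is uniform in the radius. All estimates concern squared
  norms with values in [0, \<infinity>], and |a + b|^2 \<le> 2 |a|^2 + 2 |b|^2 replaces the triangle
  inequality. The factors 2 vanish in the constants.\<close>

lemma
  fixes f :: "'a::euclidean_space \<Rightarrow> real \<Rightarrow> complex"
  assumes f: "\<And>b. b \<in> Basis \<Longrightarrow> integrable lborel (f b)"
  shows integrable_lborel_prod: "integrable lborel (\<lambda>x. \<Prod>b\<in>Basis. f b (x \<bullet> b))"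
    and integral_lborel_prod:
      "(LINT x|lborel. (\<Prod>b\<in>Basis. f b (x \<bullet> b))) = (\<Prod>b\<in>Basis. LINT u|lborel. f b u)"
proof -
  interpret product_sigma_finite "\<lambda>_::'a. lborel :: real measure" ..
  have meas: "(\<lambda>g. \<Sum>b\<in>Basis. g b *\<^sub>R b) \<in> (\<Pi>\<^sub>M b\<in>(Basis::'a set). lborel) \<rightarrow>\<^sub>M borel"
    by measurable
  have fm: "f b \<in> borel_measurable borel" if "b \<in> Basis" for b
    using borel_measurable_integrable[OF f[OF that]] by simp
  have fm': "(\<lambda>x. f b (x \<bullet> b)) \<in> borel_measurable borel" if "b \<in> Basis" for b
    by (rule measurable_compose[OF _ fm[OF that]]) simp
  have pm: "(\<lambda>x::'a. \<Prod>b\<in>Basis. f b (x \<bullet> b)) \<in> borel_measurable borel"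
    using fm' by (rule borel_measurable_prod)
  have eq: "(\<Prod>b\<in>Basis. f b ((\<Sum>c\<in>Basis. g c *\<^sub>R c) \<bullet> b)) = (\<Prod>b\<in>Basis. f b (g b))" for g
    by (rule prod.cong) simp_all
  show "integrable lborel (\<lambda>x. \<Prod>b\<in>Basis. f b (x \<bullet> b))"
    unfolding lborel_eq[where 'a='a] using product_integrable_prod[of Basis f] f
    by (subst integrable_distr_eq[OF meas pm]) (simp add: eq)
  show "(LINT x|lborel. (\<Prod>b\<in>Basis. f b (x \<bullet> b))) = (\<Prod>b\<in>Basis. LINT u|lborel. f b u)"
    unfolding lborel_eq[where 'a='a] using product_integral_prod[of Basis f] f
    by (subst integral_distr[OF meas pm]) (simp add: eq)
qed

text \<open>The substitution y = \<epsilon> x turns the weight into sqrt (2 pi) times the standard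
  normal density, so the integral is its characteristic function at -u / \<epsilon>; the factor 1 /
  \<epsilon> is the Jacobian.\<close>

lemma
  fixes u \<epsilon> :: real
  assumes \<epsilon>: "\<epsilon> > 0"
  shows integrable_fourier_gaussian_real:
      "integrable lborel (\<lambda>x. exp (- \<i> * of_real (u * x)) * of_real (exp (- (\<epsilon> * x)\<^sup>2 / 2)))"
    and fourier_gaussian_real:
      "(LINT x|lborel. exp (- \<i> * of_real (u * x)) * of_real (exp (- (\<epsilon> * x)\<^sup>2 / 2)))
        = complex_of_real (sqrt (2 * pi) / \<epsilon> * exp (- (u / \<epsilon>)\<^sup>2 / 2))"
proof -
  define h where "h y = exp (- \<i> * of_real (u / \<epsilon> * y)) * of_real (exp (- y\<^sup>2 / 2))" for y :: real
  have h: "h y = of_real (sqrt (2 * pi)) * (std_normal_density y *\<^sub>R iexp ((- u / \<epsilon>) * y))" for y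
    by (simp add: h_def normal_density_def scaleR_conv_of_real)
  have hsub: "exp (- \<i> * of_real (u * x)) * of_real (exp (- (\<epsilon> * x)\<^sup>2 / 2)) = h (\<epsilon> * x)" for x
    using \<epsilon> by (simp add: h_def)
  have int: "integrable lborel (\<lambda>y. std_normal_density y *\<^sub>R iexp ((- u / \<epsilon>) * y))"
    by (rule Bochner_Integration.integrable_bound[of lborel std_normal_density]) simp_all
  have hint: "integrable lborel h"
    unfolding h[abs_def] by (rule integrable_mult_right) (rule int)
  have "(LINT y|lborel. std_normal_density y *\<^sub>R iexp ((- u / \<epsilon>) * y)) = char std_normal_distribution (- u / \<epsilon>)"
    unfolding char_def by (rule integral_density[symmetric]) simp_all
  also have "\<dots> = of_real (exp (- (u / \<epsilon>)\<^sup>2 / 2))"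
    by (simp add: char_std_normal_distribution)
  finally have "integral\<^sup>L lborel h = of_real (sqrt (2 * pi) * exp (- (u / \<epsilon>)\<^sup>2 / 2))"
    unfolding h[abs_def] Bochner_Integration.integral_mult_right_zero by simp
  moreover have "integral\<^sup>L lborel h = \<epsilon> *\<^sub>R (LINT x|lborel. h (0 + \<epsilon> * x))"
    using lborel_integral_real_affine[of \<epsilon> h 0] \<epsilon> by simp
  ultimately show "(LINT x|lborel. exp (- \<i> * of_real (u * x)) * of_real (exp (- (\<epsilon> * x)\<^sup>2 / 2)))
        = complex_of_real (sqrt (2 * pi) / \<epsilon> * exp (- (u / \<epsilon>)\<^sup>2 / 2))"
    unfolding hsub using \<epsilon> by (simp add: scaleR_conv_of_real field_simps)
  show "integrable lborel (\<lambda>x. exp (- \<i> * of_real (u * x)) * of_real (exp (- (\<epsilon> * x)\<^sup>2 / 2)))"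
    unfolding hsub using lborel_integrable_real_affine[OF hint, of \<epsilon> 0] \<epsilon> by simp
qed

text \<open>In this parametrisation each coordinate contributes a multiple of the standard normal
  density at \<epsilon> times the coordinate, and the weight increases to 1 as \<epsilon> decreases
  to 0.\<close>

definition gaussian :: "real \<Rightarrow> 'a::euclidean_space \<Rightarrow> real" where
  "gaussian \<epsilon> x = exp (- (\<epsilon> * norm x)\<^sup>2 / 2)"

lemma gaussian_pos: "gaussian \<epsilon> x > 0"
  by (simp add: gaussian_def)

lemma measurable_gaussian [measurable]: "gaussian \<epsilon> \<in> borel_measurable borel"
  unfolding gaussian_def by measurable

lemma gaussian_eq_prod: "gaussian \<epsilon> x = (\<Prod>b\<in>Basis. exp (- (\<epsilon> * (x \<bullet> b))\<^sup>2 / 2))"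
proof -
  have "(\<epsilon> * norm x)\<^sup>2 = (\<Sum>b\<in>Basis. (\<epsilon> * (x \<bullet> b))\<^sup>2)"
    unfolding power_mult_distrib sum_distrib_left[symmetric] power2_norm_eq_inner
      euclidean_inner[of x x] by (simp only: power2_eq_square)
  then show ?thesis
    by (simp add: gaussian_def exp_sum[symmetric] sum_negf sum_divide_distrib)
qed

lemma exp_inner_eq_prod:
  "exp (- \<i> * of_real (x \<bullet> \<xi>)) = (\<Prod>b\<in>Basis. exp (- \<i> * of_real ((x \<bullet> b) * (\<xi> \<bullet> b))))"
  by (subst euclidean_inner) (simp add: exp_sum[symmetric] sum_distrib_left)

text \<open>This is the Fourier integral of \<open>gaussian \<epsilon>\<close> without the
  normalising factor (see \<open>fourier_gaussian\<close>). It is nonnegative and its mass does not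
  depend on \<epsilon>, so convolution with it is bounded on L2 uniformly in \<epsilon>.\<close>

definition gauss_kernel :: "real \<Rightarrow> 'a::euclidean_space \<Rightarrow> real" where
  "gauss_kernel \<epsilon> z = (sqrt (2 * pi) / \<epsilon>) ^ DIM('a) * gaussian (1 / \<epsilon>) z"

lemma measurable_gauss_kernel [measurable]: "gauss_kernel \<epsilon> \<in> borel_measurable borel"
  unfolding gauss_kernel_def by measurable

lemma gauss_kernel_eq_prod:
  "gauss_kernel \<epsilon> (z::'a::euclidean_space)
     = (\<Prod>b\<in>Basis. sqrt (2 * pi) / \<epsilon> * exp (- (z \<bullet> b / \<epsilon>)\<^sup>2 / 2))"
  unfolding prod.distrib by (simp add: gauss_kernel_def gaussian_eq_prod)

lemma
  fixes z :: "'a::euclidean_space"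
  assumes \<epsilon>: "\<epsilon> > 0"
  shows integrable_fourier_gaussian:
      "integrable lborel (\<lambda>\<xi>. exp (- \<i> * of_real (z \<bullet> \<xi>)) * of_real (gaussian \<epsilon> \<xi>))"
    and fourier_gaussian:
      "(LINT \<xi>|lborel. exp (- \<i> * of_real (z \<bullet> \<xi>)) * of_real (gaussian \<epsilon> \<xi>))
        = complex_of_real (gauss_kernel \<epsilon> z)"
proof -
  define f where "f b u = exp (- \<i> * of_real ((z \<bullet> b) * u)) * of_real (exp (- (\<epsilon> * u)\<^sup>2 / 2))"
    for b :: 'a and u :: real
  have eq: "exp (- \<i> * of_real (z \<bullet> \<xi>)) * of_real (gaussian \<epsilon> \<xi>) = (\<Prod>b\<in>Basis. f b (\<xi> \<bullet> b))" for \<xi>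
    unfolding exp_inner_eq_prod gaussian_eq_prod f_def prod.distrib by simp
  have f: "integrable lborel (f b)" for b
    unfolding f_def by (rule integrable_fourier_gaussian_real[OF \<epsilon>])
  show "integrable lborel (\<lambda>\<xi>. exp (- \<i> * of_real (z \<bullet> \<xi>)) * of_real (gaussian \<epsilon> \<xi>))"
    unfolding eq by (rule integrable_lborel_prod[OF f])
  have fb: "(LINT u|lborel. f b u) = of_real (sqrt (2 * pi) / \<epsilon> * exp (- (z \<bullet> b / \<epsilon>)\<^sup>2 / 2))" for b
    unfolding f_def by (rule fourier_gaussian_real[OF \<epsilon>])
  show "(LINT \<xi>|lborel. exp (- \<i> * of_real (z \<bullet> \<xi>)) * of_real (gaussian \<epsilon> \<xi>))
        = complex_of_real (gauss_kernel \<epsilon> z)"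
    unfolding eq integral_lborel_prod[OF f] fb gauss_kernel_eq_prod by (simp only: of_real_prod)
qed

lemma gauss_kernel_nonneg: "\<epsilon> > 0 \<Longrightarrow> gauss_kernel \<epsilon> z \<ge> 0"
  by (simp add: gauss_kernel_def gaussian_def)

lemma integrable_gaussian: "\<epsilon> > 0 \<Longrightarrow> integrable lborel (gaussian \<epsilon> :: 'a::euclidean_space \<Rightarrow> real)"
  using integrable_norm[OF integrable_fourier_gaussian[of \<epsilon> "0::'a"]]
  by (simp add: abs_of_pos gaussian_pos)

text \<open>The integral of the Gaussian with parameter 1 / \<epsilon> is the value of its Fourier
  integral at 0, so \<open>fourier_gaussian\<close> evaluates it; then the powers of \<epsilon>
  cancel.\<close>

lemma nn_integral_gauss_kernel:
  assumes \<epsilon>: "\<epsilon> > 0"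
  shows "(\<integral>\<^sup>+ z. ennreal (gauss_kernel \<epsilon> (z::'a::euclidean_space)) \<partial>lborel) = ennreal ((2 * pi) ^ DIM('a))"
proof -
  have int: "integrable lborel (gaussian (1 / \<epsilon>) :: 'a \<Rightarrow> real)"
    using \<epsilon> by (intro integrable_gaussian) simp
  have "complex_of_real (LINT z|lborel. gaussian (1 / \<epsilon>) (z::'a)) = of_real (gauss_kernel (1 / \<epsilon>) (0::'a))"
    using fourier_gaussian[of "1 / \<epsilon>" "0::'a"] \<epsilon> by simp
  then have "(LINT z|lborel. gaussian (1 / \<epsilon>) (z::'a)) = gauss_kernel (1 / \<epsilon>) (0::'a)"
    using of_real_eq_iff by blast
  also have "\<dots> = (sqrt (2 * pi) * \<epsilon>) ^ DIM('a)"
    by (simp add: gauss_kernel_def gaussian_def)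
  finally have 1: "(LINT z|lborel. gauss_kernel \<epsilon> (z::'a)) = (sqrt (2 * pi) / \<epsilon>) ^ DIM('a) * (sqrt (2 * pi) * \<epsilon>) ^ DIM('a)"
    by (simp add: gauss_kernel_def)
  also have "\<dots> = (2 * pi) ^ DIM('a)"
    unfolding power_mult_distrib[symmetric] using \<epsilon> by simp
  finally show ?thesis
    using gauss_kernel_nonneg[OF \<epsilon>, where 'a='a] integrable_mult_right[OF int]
    by (subst nn_integral_eq_integral) (simp_all only: gauss_kernel_def[abs_def] AE_I2)
qed

section \<open>The Plancherel inequality with a Gaussian weight\<close>

lemma integrable_lborel_mult_pair:
  fixes f g :: "'a::euclidean_space \<Rightarrow> complex"
  assumes f: "integrable lborel f" and g: "integrable lborel g"
  shows "integrable (lborel \<Otimes>\<^sub>M lborel) (\<lambda>(x, y). f x * g y)"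
proof (rule lborel_pair.Fubini_integrable)
  have [measurable]: "f \<in> borel_measurable borel" "g \<in> borel_measurable borel"
    using f g by (auto dest: borel_measurable_integrable)
  show "(\<lambda>(x, y). f x * g y) \<in> borel_measurable (lborel \<Otimes>\<^sub>M lborel)" by measurable
  show "integrable lborel (\<lambda>x. LINT y|lborel. norm (case (x, y) of (x, y) \<Rightarrow> f x * g y))"
    using f by (simp add: norm_mult)
  show "AE x in lborel. integrable lborel (\<lambda>y. case (x, y) of (x, y) \<Rightarrow> f x * g y)"
    using g by simp
qed

lemma nn_integral_lborel_diff:
  fixes h :: "'a::euclidean_space \<Rightarrow> ennreal"
  assumes [measurable]: "h \<in> borel_measurable borel"
  shows "(\<integral>\<^sup>+ x. h (x - y) \<partial>lborel) = (\<integral>\<^sup>+ x. h x \<partial>lborel)"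
proof -
  have "(\<integral>\<^sup>+ x. h (x - y) \<partial>lborel) = (\<integral>\<^sup>+ x. h (x - y) \<partial>distr lborel borel ((+) y))"
    by (simp only: lborel_distr_plus)
  also have "\<dots> = (\<integral>\<^sup>+ x. h x \<partial>lborel)"
    by (subst nn_integral_distr) simp_all
  finally show ?thesis .
qed

lemma gauss_kernel_minus_commute: "gauss_kernel \<epsilon> (x - y) = gauss_kernel \<epsilon> (y - x)"
  by (simp add: gauss_kernel_def gaussian_def norm_minus_commute)

lemma nn_integral_gauss_kernel_convolution_le:
  fixes f :: "'a::euclidean_space \<Rightarrow> complex"
  assumes [measurable]: "f \<in> borel_measurable borel" and \<epsilon>: "\<epsilon> > 0"
  shows "(\<integral>\<^sup>+ x. \<integral>\<^sup>+ y. ennreal (cmod (f x) * (cmod (f y) * gauss_kernel \<epsilon> (x - y))) \<partial>lborel \<partial>lborel)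
      \<le> ennreal ((2 * pi) ^ DIM('a)) * (\<integral>\<^sup>+ x. ennreal ((cmod (f x))\<^sup>2) \<partial>lborel)"
proof -
  define K where "K = ennreal ((2 * pi) ^ DIM('a))"
  define e where "e x = ennreal ((cmod (f x))\<^sup>2 / 2)" for x
  define k where "k z = ennreal (gauss_kernel \<epsilon> z)" for z :: 'a
  have [measurable]: "e \<in> borel_measurable borel" "k \<in> borel_measurable borel"
    unfolding e_def k_def by measurable
  have kx: "(\<integral>\<^sup>+ x. k (x - y) \<partial>lborel) = K" for y
    by (subst nn_integral_lborel_diff) (simp_all add: k_def[abs_def] nn_integral_gauss_kernel[OF \<epsilon>] K_def)
  have ky: "(\<integral>\<^sup>+ y. k (x - y) \<partial>lborel) = K" for x
    using kx[of x] by (simp add: k_def gauss_kernel_minus_commute)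
  have le: "ennreal (cmod (f x) * (cmod (f y) * gauss_kernel \<epsilon> (x - y)))
      \<le> e x * k (x - y) + e y * k (x - y)" for x y
  proof -
    have "cmod (f x) * cmod (f y) \<le> (cmod (f x))\<^sup>2 / 2 + (cmod (f y))\<^sup>2 / 2"
      using sum_squares_bound[of "cmod (f x)" "cmod (f y)"] by simp
    then have "cmod (f x) * (cmod (f y) * gauss_kernel \<epsilon> (x - y))
        \<le> ((cmod (f x))\<^sup>2 / 2 + (cmod (f y))\<^sup>2 / 2) * gauss_kernel \<epsilon> (x - y)"
      using gauss_kernel_nonneg[OF \<epsilon>, of "x - y"]
      by (simp add: mult.assoc[symmetric] mult_right_mono)
    then show ?thesis
      using gauss_kernel_nonneg[OF \<epsilon>, of "x - y"]
      by (simp add: e_def k_def ennreal_mult'[symmetric] ennreal_plus[symmetric] ring_distribs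
          ennreal_leI del: ennreal_plus)
  qed
  have "(\<integral>\<^sup>+ x. \<integral>\<^sup>+ y. ennreal (cmod (f x) * (cmod (f y) * gauss_kernel \<epsilon> (x - y))) \<partial>lborel \<partial>lborel)
      \<le> (\<integral>\<^sup>+ x. \<integral>\<^sup>+ y. e x * k (x - y) + e y * k (x - y) \<partial>lborel \<partial>lborel)"
    by (intro nn_integral_mono le)
  also have "\<dots> = (\<integral>\<^sup>+ x. (\<integral>\<^sup>+ y. e x * k (x - y) \<partial>lborel) + (\<integral>\<^sup>+ y. e y * k (x - y) \<partial>lborel) \<partial>lborel)"
    by (simp add: nn_integral_add)
  also have "\<dots> = (\<integral>\<^sup>+ x. \<integral>\<^sup>+ y. e x * k (x - y) \<partial>lborel \<partial>lborel) + (\<integral>\<^sup>+ x. \<integral>\<^sup>+ y. e y * k (x - y) \<partial>lborel \<partial>lborel)"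
    by (rule nn_integral_add) simp_all
  also have "(\<integral>\<^sup>+ x. \<integral>\<^sup>+ y. e y * k (x - y) \<partial>lborel \<partial>lborel) = (\<integral>\<^sup>+ y. \<integral>\<^sup>+ x. e y * k (x - y) \<partial>lborel \<partial>lborel)"
    by (rule lborel_pair.Fubini'[symmetric]) simp
  also have "(\<integral>\<^sup>+ x. \<integral>\<^sup>+ y. e x * k (x - y) \<partial>lborel \<partial>lborel) = (\<integral>\<^sup>+ x. e x * K \<partial>lborel)"
    by (simp add: nn_integral_cmult ky)
  also have "(\<integral>\<^sup>+ y. \<integral>\<^sup>+ x. e y * k (x - y) \<partial>lborel \<partial>lborel) = (\<integral>\<^sup>+ x. e x * K \<partial>lborel)"
    by (simp add: nn_integral_cmult kx)
  also have "(\<integral>\<^sup>+ x. e x * K \<partial>lborel) + (\<integral>\<^sup>+ x. e x * K \<partial>lborel) = (\<integral>\<^sup>+ x. K * ennreal ((cmod (f x))\<^sup>2) \<partial>lborel)"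
    by (subst nn_integral_add[symmetric])
      (simp_all add: e_def distrib_left[symmetric] ennreal_plus[symmetric] mult.commute del: ennreal_plus)
  also have "\<dots> = K * (\<integral>\<^sup>+ x. ennreal ((cmod (f x))\<^sup>2) \<partial>lborel)"
    by (rule nn_integral_cmult) simp
  finally show ?thesis unfolding K_def .
qed

text \<open>The two factors of |U|^2 are written as integrals over x and y. The remaining integral
  over \<xi> is the transform of the Gaussian at x - y, a nonnegative kernel, and the convolution
  bound applies. The weight makes both exchanges of integrals absolutely convergent.\<close>

lemma nn_integral_gaussian_fourier_le:
  fixes f :: "'a::euclidean_space \<Rightarrow> complex"
  assumes f: "integrable lborel f" and \<epsilon>: "\<epsilon> > 0"
  defines "U \<equiv> \<lambda>\<xi>. LINT x|lborel. exp (- \<i> * of_real (x \<bullet> \<xi>)) * f x"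
  shows "(\<integral>\<^sup>+ \<xi>. ennreal (gaussian \<epsilon> \<xi> * (cmod (U \<xi>))\<^sup>2) \<partial>lborel)
    \<le> ennreal ((2 * pi) ^ DIM('a)) * (\<integral>\<^sup>+ x. ennreal ((cmod (f x))\<^sup>2) \<partial>lborel)"
proof -
  have fm [measurable]: "f \<in> borel_measurable borel"
    using borel_measurable_integrable[OF f] by simp
  have Um [measurable]: "U \<in> borel_measurable borel"
    unfolding U_def by measurable
  define g where "g \<xi> = complex_of_real (gaussian \<epsilon> \<xi>)" for \<xi> :: 'a
  have gm [measurable]: "g \<in> borel_measurable borel" unfolding g_def by measurable
  have g: "integrable lborel g"
    unfolding g_def by (intro integrable_of_real integrable_gaussian \<epsilon>)
  have fc: "integrable lborel (\<lambda>y. cnj (f y))" using f by simp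
  have [measurable]: "(\<lambda>y. cnj (f y)) \<in> borel_measurable borel"
    using borel_measurable_integrable[OF fc] by simp
  have nexp: "cmod (exp (- \<i> * of_real r)) = 1" "cmod (exp (\<i> * of_real r)) = 1" for r
    by (simp_all add: norm_exp_eq_Re)
  have Ub: "cmod (U \<xi>) \<le> (LINT x|lborel. cmod (f x))" for \<xi>
    unfolding U_def using integral_norm_bound[of lborel "\<lambda>x. exp (- \<i> * of_real (x \<bullet> \<xi>)) * f x"]
    by (simp add: norm_mult nexp)
  have Ucnj: "cnj (U \<xi>) = (LINT y|lborel. exp (\<i> * of_real (y \<bullet> \<xi>)) * cnj (f y))" for \<xi>
    unfolding U_def by (subst Bochner_Integration.integral_cnj[symmetric]) (simp add: exp_cnj)
  have [measurable]: "(\<lambda>\<xi>. cnj (U \<xi>)) \<in> borel_measurable borel"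
    by (rule measurable_compose[OF Um]) (intro borel_measurable_continuous_onI continuous_intros)
  have gU: "integrable lborel (\<lambda>\<xi>. g \<xi> * cnj (U \<xi>))"
    by (rule Bochner_Integration.integrable_bound[OF integrable_mult_right[OF g,
          of "of_real (LINT x|lborel. cmod (f x))"]])
       (use Ub order_trans[OF _ abs_ge_self] in
         \<open>auto simp: norm_mult mult.commute[of "cmod (g _)"] intro!: mult_right_mono\<close>)
  \<comment> \<open>The conjugate of \<open>U\<close> is opened as an integral over y and the order
    is exchanged; inside remains the transform of the Gaussian at x - y.\<close>
  have V: "(LINT \<xi>|lborel. g \<xi> * cnj (U \<xi>) * exp (- \<i> * of_real (x \<bullet> \<xi>)))
      = (LINT y|lborel. cnj (f y) * of_real (gauss_kernel \<epsilon> (x - y)))" (is "?V x = _") for x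
  proof -
    have "?V x = (LINT \<xi>|lborel. LINT y|lborel. exp (- \<i> * of_real ((x - y) \<bullet> \<xi>)) * g \<xi> * cnj (f y))"
      unfolding Ucnj integral_mult_left_zero[symmetric] integral_mult_right_zero[symmetric]
      by (intro Bochner_Integration.integral_cong refl)
         (simp add: inner_diff_left exp_diff exp_minus field_simps)
    also have "\<dots> = (LINT y|lborel. LINT \<xi>|lborel. exp (- \<i> * of_real ((x - y) \<bullet> \<xi>)) * g \<xi> * cnj (f y))"
      by (rule lborel_pair.Fubini_integral,
          rule Bochner_Integration.integrable_bound[OF integrable_lborel_mult_pair[OF fc g]])
         (auto simp: norm_mult nexp split_beta mult.commute)
    also have "\<dots> = (LINT y|lborel. cnj (f y) * of_real (gauss_kernel \<epsilon> (x - y)))"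
      using fourier_gaussian[OF \<epsilon>, of "x - y" for y] by (simp add: g_def mult.commute)
    finally show ?thesis .
  qed
  have intP: "integrable (lborel \<Otimes>\<^sub>M lborel)
      (\<lambda>(x, \<xi>). f x * (g \<xi> * cnj (U \<xi>) * exp (- \<i> * of_real (x \<bullet> \<xi>))))"
    by (rule Bochner_Integration.integrable_bound[OF integrable_lborel_mult_pair[OF f gU]])
       (auto simp: norm_mult nexp split_beta)
  have "(LINT \<xi>|lborel. g \<xi> * (U \<xi> * cnj (U \<xi>)))
      = (LINT \<xi>|lborel. LINT x|lborel. f x * (g \<xi> * cnj (U \<xi>) * exp (- \<i> * of_real (x \<bullet> \<xi>))))"
  proof (intro Bochner_Integration.integral_cong refl)
    fix \<xi>
    have "g \<xi> * (U \<xi> * cnj (U \<xi>)) = (g \<xi> * cnj (U \<xi>)) * U \<xi>" by (simp add: mult_ac)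
    also have "\<dots> = (LINT x|lborel. (g \<xi> * cnj (U \<xi>)) * (exp (- \<i> * of_real (x \<bullet> \<xi>)) * f x))"
      unfolding U_def by (rule integral_mult_right_zero[symmetric])
    finally show "g \<xi> * (U \<xi> * cnj (U \<xi>)) = (LINT x|lborel. f x * (g \<xi> * cnj (U \<xi>) * exp (- \<i> * of_real (x \<bullet> \<xi>))))"
      by (simp add: mult_ac)
  qed
  also have "\<dots> = (LINT x|lborel. f x * ?V x)"
    by (subst lborel_pair.Fubini_integral[OF intP]) simp
  finally have J: "(LINT \<xi>|lborel. g \<xi> * (U \<xi> * cnj (U \<xi>))) = (LINT x|lborel. f x * ?V x)" .
  have intV: "integrable lborel (\<lambda>x. f x * ?V x)"
    using lborel_pair.integrable_fst'[OF intP] by simp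
  have gUU: "g \<xi> * (U \<xi> * cnj (U \<xi>)) = of_real (gaussian \<epsilon> \<xi> * (cmod (U \<xi>))\<^sup>2)" for \<xi>
    by (simp add: g_def complex_norm_square del: of_real_power)
  have int: "integrable lborel (\<lambda>\<xi>. gaussian \<epsilon> \<xi> * (cmod (U \<xi>))\<^sup>2)"
    by (rule Bochner_Integration.integrable_bound[OF integrable_mult_right[OF integrable_gaussian[OF \<epsilon>],
          of "(LINT x|lborel. cmod (f x))\<^sup>2"]])
       (auto simp: abs_mult less_imp_le[OF gaussian_pos] mult.commute
             intro!: mult_left_mono power_mono Ub)
  have "(\<integral>\<^sup>+ \<xi>. ennreal (gaussian \<epsilon> \<xi> * (cmod (U \<xi>))\<^sup>2) \<partial>lborel)
      = ennreal (LINT \<xi>|lborel. gaussian \<epsilon> \<xi> * (cmod (U \<xi>))\<^sup>2)"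
    by (rule nn_integral_eq_integral[OF int]) (simp add: less_imp_le[OF gaussian_pos])
  also have "(LINT \<xi>|lborel. gaussian \<epsilon> \<xi> * (cmod (U \<xi>))\<^sup>2) \<le> cmod (LINT \<xi>|lborel. g \<xi> * (U \<xi> * cnj (U \<xi>)))"
    unfolding gUU by (simp del: of_real_mult)
  also have "ennreal (cmod (LINT \<xi>|lborel. g \<xi> * (U \<xi> * cnj (U \<xi>)))) \<le> (\<integral>\<^sup>+ x. ennreal (cmod (f x * ?V x)) \<partial>lborel)"
    unfolding J by (rule integral_norm_bound_ennreal[OF intV])
  also have "\<dots> \<le> (\<integral>\<^sup>+ x. \<integral>\<^sup>+ y. ennreal (cmod (f x) * (cmod (f y) * gauss_kernel \<epsilon> (x - y))) \<partial>lborel \<partial>lborel)"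
  proof (rule nn_integral_mono)
    fix x :: 'a
    have k: "cmod (of_real (gauss_kernel \<epsilon> z)) = gauss_kernel \<epsilon> z" for z :: 'a
      using gauss_kernel_nonneg[OF \<epsilon>, of z] by simp
    have "ennreal (cmod (?V x)) \<le> (\<integral>\<^sup>+ y. ennreal (cmod (f y) * gauss_kernel \<epsilon> (x - y)) \<partial>lborel)"
    proof (cases "integrable lborel (\<lambda>y. cnj (f y) * of_real (gauss_kernel \<epsilon> (x - y)))")
      case True
      from integral_norm_bound_ennreal[OF this] show ?thesis
        unfolding V norm_mult k by simp
    next
      \<comment> \<open>The Bochner integral then has the default value 0, so the bound is
        trivial.\<close>
      case False
      then show ?thesis unfolding V by (simp add: not_integrable_integral_eq)
    qed
    then have "ennreal (cmod (f x)) * ennreal (cmod (?V x))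
        \<le> ennreal (cmod (f x)) * (\<integral>\<^sup>+ y. ennreal (cmod (f y) * gauss_kernel \<epsilon> (x - y)) \<partial>lborel)"
      by (rule mult_left_mono) simp
    also have "\<dots> = (\<integral>\<^sup>+ y. ennreal (cmod (f x)) * ennreal (cmod (f y) * gauss_kernel \<epsilon> (x - y)) \<partial>lborel)"
      by (rule nn_integral_cmult[symmetric]) simp
    finally show "ennreal (cmod (f x * ?V x))
        \<le> (\<integral>\<^sup>+ y. ennreal (cmod (f x) * (cmod (f y) * gauss_kernel \<epsilon> (x - y))) \<partial>lborel)"
      by (simp add: norm_mult ennreal_mult')
  qed
  also have "\<dots> \<le> ennreal ((2 * pi) ^ DIM('a)) * (\<integral>\<^sup>+ x. ennreal ((cmod (f x))\<^sup>2) \<partial>lborel)"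
    by (rule nn_integral_gauss_kernel_convolution_le[OF fm \<epsilon>])
  finally show ?thesis by (simp add: ennreal_leI)
qed

section \<open>Energy and the Fourier transform\<close>

text \<open>The square of \<open>norm_L2\<close>, without its case distinction and root. It is
  additive under integration, so all estimates are made with it, and
  \<open>ennreal_square_le_imp_le\<close> returns to norms at the end.\<close>

definition energy :: "('a::euclidean_space \<Rightarrow> complex) \<Rightarrow> ennreal" where
  "energy f = (\<integral>\<^sup>+ x. ennreal ((cmod (f x))\<^sup>2) \<partial>lebesgue)"

lemma norm_L2_square: "(norm_L2 f)\<^sup>2 = energy f"
proof (cases "energy f")
  case (real r)
  then have "norm_L2 f = ennreal (sqrt r)"
    by (simp add: norm_L2_def energy_def Let_def)
  then show ?thesis using real by (simp add: ennreal_power)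
next
  case top
  then have "norm_L2 f = \<infinity>" by (simp add: norm_L2_def energy_def Let_def)
  then show ?thesis using top by (simp add: power2_eq_square)
qed

lemma norm_L2_finite_iff: "norm_L2 f < \<infinity> \<longleftrightarrow> energy f < \<infinity>"
  by (auto simp: norm_L2_def energy_def Let_def less_top[symmetric])

lemma L2_energy_finite: "f \<in> L2 \<Longrightarrow> energy f < \<infinity>"
  using norm_L2_finite_iff[of f] by (simp add: L2_def)

lemma ennreal_square_le_imp_le:
  fixes x y :: ennreal
  assumes "x\<^sup>2 \<le> y\<^sup>2"
  shows "x \<le> y"
proof (cases "y = \<infinity>")
  case False
  then obtain q where q: "y = ennreal q" "q \<ge> 0" by (cases y) auto
  with assms have "x \<noteq> \<infinity>" by (auto simp: power2_eq_square ennreal_mult_eq_top_iff top_unique)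
  then obtain p where p: "x = ennreal p" "p \<ge> 0" by (cases x) auto
  from assms have "p\<^sup>2 \<le> q\<^sup>2" unfolding p q by (simp add: ennreal_power p q)
  then have "p \<le> q" by (rule power2_le_imp_le) (rule q)
  then show ?thesis unfolding p q by (rule ennreal_leI)
qed simp

lemma energy_cong_AE: "AE x in lebesgue. f x = g x \<Longrightarrow> energy f = energy g"
  unfolding energy_def by (rule nn_integral_cong_AE) auto

lemma energy_eq_lborel: "f \<in> borel_measurable borel \<Longrightarrow> energy f = (\<integral>\<^sup>+ x. ennreal ((cmod (f x))\<^sup>2) \<partial>lborel)"
  unfolding energy_def by (simp add: nn_integral_completion)

text \<open>The exchanges of integrals take place on products of \<open>lborel\<close>, whereas the
  data are only Lebesgue measurable; passing to a Borel version bridges the two.\<close>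

lemma ex_borel_version:
  fixes f :: "'a::euclidean_space \<Rightarrow> complex"
  assumes "f \<in> borel_measurable lebesgue"
  shows "\<exists>g\<in>borel_measurable borel. AE x in lebesgue. f x = g x"
proof -
  have "(\<lambda>x. Re (f x)) \<in> borel_measurable lebesgue" "(\<lambda>x. Im (f x)) \<in> borel_measurable lebesgue"
    using assms by auto
  from this[THEN completion_ex_borel_measurable_real] obtain u v
    where u [measurable]: "u \<in> borel_measurable lborel" and v [measurable]: "v \<in> borel_measurable lborel"
      and "AE x in lborel. Re (f x) = u x" "AE x in lborel. Im (f x) = v x"
    by blast
  from this(3,4) have "AE x in lborel. f x = Complex (u x) (v x)"
    by eventually_elim (simp add: complex_eq_iff)
  then have "AE x in lebesgue. f x = Complex (u x) (v x)"
    by (rule AE_completion)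
  moreover have "(\<lambda>x. Complex (u x) (v x)) \<in> borel_measurable borel"
    using u v unfolding borel_measurable_complex_iff by simp
  ultimately show ?thesis by (rule bexI)
qed

section \<open>Elementary inequalities for the energy\<close>

lemma cmod_add_square_le: "(cmod (a + b))\<^sup>2 \<le> 2 * (cmod a)\<^sup>2 + 2 * (cmod b)\<^sup>2"
proof -
  have "(cmod (a + b))\<^sup>2 \<le> (cmod a + cmod b)\<^sup>2"
    by (intro power_mono norm_triangle_ineq) simp
  also have "\<dots> \<le> 2 * (cmod a)\<^sup>2 + 2 * (cmod b)\<^sup>2"
    using sum_squares_bound[of "cmod a" "cmod b"] by (simp add: power2_sum)
  finally show ?thesis .
qed

lemma energy_mono: "(\<And>x. cmod (f x) \<le> cmod (g x)) \<Longrightarrow> energy f \<le> energy g"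
  unfolding energy_def by (intro nn_integral_mono ennreal_leI power_mono) auto

lemma energy_cmult: "f \<in> borel_measurable lebesgue \<Longrightarrow> energy (\<lambda>x. c * f x) = ennreal ((cmod c)\<^sup>2) * energy f"
  unfolding energy_def
  by (subst nn_integral_cmult[symmetric]) (auto simp: norm_mult power_mult_distrib ennreal_mult)

lemma energy_add_le:
  assumes [measurable]: "f \<in> borel_measurable lebesgue" "g \<in> borel_measurable lebesgue"
  shows "energy (\<lambda>x. f x + g x) \<le> 2 * energy f + 2 * energy g"
proof -
  have "energy (\<lambda>x. f x + g x)
      \<le> (\<integral>\<^sup>+ x. 2 * ennreal ((cmod (f x))\<^sup>2) + 2 * ennreal ((cmod (g x))\<^sup>2) \<partial>lebesgue)"
    unfolding energy_def
  proof (rule nn_integral_mono)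
    fix x
    have "ennreal ((cmod (f x + g x))\<^sup>2) \<le> ennreal (2 * (cmod (f x))\<^sup>2 + 2 * (cmod (g x))\<^sup>2)"
      by (intro ennreal_leI cmod_add_square_le)
    then show "ennreal ((cmod (f x + g x))\<^sup>2) \<le> 2 * ennreal ((cmod (f x))\<^sup>2) + 2 * ennreal ((cmod (g x))\<^sup>2)"
      by (simp add: ennreal_mult)
  qed
  also have "\<dots> = 2 * energy f + 2 * energy g"
    unfolding energy_def by (simp add: nn_integral_add nn_integral_cmult)
  finally show ?thesis .
qed

section \<open>The Fourier integral of L1 functions and the Plancherel inequality\<close>

lemma fourier_integral_eq_borel:
  fixes f g :: "'a::euclidean_space \<Rightarrow> complex"
  assumes f: "f \<in> borel_measurable lebesgue" and g [measurable]: "g \<in> borel_measurable borel"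
    and eq: "AE x in lebesgue. f x = g x"
  shows "fourier_integral f \<xi> = of_real ((2 * pi) powr (- real DIM('a) / 2)) *
     (LINT x|lborel. exp (- \<i> * of_real (x \<bullet> \<xi>)) * g x)"
proof -
  have [measurable]: "(\<lambda>x. exp (- \<i> * of_real (x \<bullet> \<xi>)) * g x) \<in> borel_measurable borel" by measurable
  have e: "(\<lambda>x. exp (- \<i> * of_real (x \<bullet> \<xi>))) \<in> borel_measurable lebesgue"
    by (rule measurable_completion) simp
  have "(LINT x|lebesgue. exp (- \<i> * of_real (x \<bullet> \<xi>)) * f x)
      = (LINT x|lebesgue. exp (- \<i> * of_real (x \<bullet> \<xi>)) * g x)"
    using eq by (intro integral_cong_AE borel_measurable_times e f) (auto intro: measurable_completion)
  then show ?thesis unfolding fourier_integral_def by (simp add: integral_completion)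
qed

lemma L1_imp_integrable: "f \<in> L1 \<Longrightarrow> integrable lebesgue f"
  by (simp add: L1_def norm_L1_def integrable_iff_bounded)

lemma integrable_borel_version:
  assumes "f \<in> L1" and [measurable]: "g \<in> borel_measurable borel" and "AE x in lebesgue. f x = g x"
  shows "integrable lborel g"
proof -
  have "integrable lebesgue g"
    using L1_imp_integrable[OF assms(1)] assms(3)
    by (subst integrable_cong_AE[where g=f]) (auto intro: measurable_completion borel_measurable_integrable)
  then show ?thesis by (simp add: integrable_completion)
qed

lemma fourier_integral_measurable:
  assumes "f \<in> borel_measurable lebesgue"
  shows "fourier_integral f \<in> borel_measurable borel"
proof -
  obtain g where g [measurable]: "g \<in> borel_measurable borel" and eq: "AE x in lebesgue. f x = g x"
    using ex_borel_version[OF assms] by blast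
  show ?thesis
    unfolding fourier_integral_eq_borel[OF assms g eq] by measurable
qed

text \<open>Take \<epsilon> = 1 / (k + 1): the weights increase to 1, so monotone convergence
  carries over the weighted bound, which is uniform in \<epsilon>. Its factor (2 pi)^n is cancelled
  by the square of the normalising constant \<open>c\<close>.\<close>

theorem energy_fourier_integral_le:
  fixes f :: "'a::euclidean_space \<Rightarrow> complex"
  assumes f: "f \<in> L1"
  shows "energy (fourier_integral f) \<le> energy f"
proof -
  have fm: "f \<in> borel_measurable lebesgue" using f by (simp add: L1_def)
  obtain g where g [measurable]: "g \<in> borel_measurable borel" and eq: "AE x in lebesgue. f x = g x"
    using ex_borel_version[OF fm] by blast
  have gi: "integrable lborel g" by (rule integrable_borel_version[OF f g eq])
  define U where "U \<xi> = (LINT x|lborel. exp (- \<i> * of_real (x \<bullet> \<xi>)) * g x)" for \<xi>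
  have [measurable]: "U \<in> borel_measurable borel" unfolding U_def by measurable
  define c where "c = (2 * pi) powr (- real DIM('a) / 2)"
  have c: "c\<^sup>2 * (2 * pi) ^ DIM('a) = 1"
  proof -
    have "c\<^sup>2 = (2 * pi) powr (- real DIM('a))"
      by (simp add: c_def powr_power)
    also have "\<dots> = inverse ((2 * pi) ^ DIM('a))"
      by (subst powr_minus, subst powr_realpow) simp_all
    finally show ?thesis by (simp only:) (rule left_inverse, simp)
  qed
  have FI: "fourier_integral f \<xi> = of_real c * U \<xi>" for \<xi>
    unfolding c_def U_def by (rule fourier_integral_eq_borel[OF fm g eq])
  define e where "e k \<xi> = ennreal (gaussian (1 / real (Suc k)) \<xi> * (cmod (U \<xi>))\<^sup>2)" for k and \<xi> :: 'a
  have mono: "incseq e"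
  proof (rule incseq_SucI, rule le_funI)
    fix k and \<xi> :: 'a
    have "1 / real (Suc (Suc k)) * norm \<xi> \<le> 1 / real (Suc k) * norm \<xi>"
      by (intro mult_right_mono divide_left_mono) auto
    then have "(1 / real (Suc (Suc k)) * norm \<xi>)\<^sup>2 \<le> (1 / real (Suc k) * norm \<xi>)\<^sup>2"
      by (intro power_mono) auto
    then show "e k \<xi> \<le> e (Suc k) \<xi>"
      unfolding e_def gaussian_def by (intro ennreal_leI mult_right_mono) auto
  qed
  have lim: "(\<lambda>k. e k \<xi>) \<longlonglongrightarrow> ennreal ((cmod (U \<xi>))\<^sup>2)" for \<xi>
  proof -
    have "(\<lambda>k. inverse (real (Suc k))) \<longlonglongrightarrow> 0" by (rule LIMSEQ_inverse_real_of_nat)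
    then have "(\<lambda>k. exp (- (inverse (real (Suc k)) * norm \<xi>)\<^sup>2 / 2) * (cmod (U \<xi>))\<^sup>2)
        \<longlonglongrightarrow> exp (- (0 * norm \<xi>)\<^sup>2 / 2) * (cmod (U \<xi>))\<^sup>2"
      by (intro tendsto_intros) auto
    then show ?thesis unfolding e_def gaussian_def by (intro tendsto_ennrealI) (simp add: inverse_eq_divide)
  qed
  have "(\<integral>\<^sup>+ \<xi>. ennreal ((cmod (U \<xi>))\<^sup>2) \<partial>lborel) \<le> ennreal ((2 * pi) ^ DIM('a)) * energy g"
  proof (rule LIMSEQ_le_const2)
    show "(\<lambda>k. \<integral>\<^sup>+ \<xi>. e k \<xi> \<partial>lborel) \<longlonglongrightarrow> (\<integral>\<^sup>+ \<xi>. ennreal ((cmod (U \<xi>))\<^sup>2) \<partial>lborel)"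
      by (rule nn_integral_LIMSEQ[OF mono _ lim]) (simp add: e_def[abs_def])
    show "\<exists>N. \<forall>k\<ge>N. (\<integral>\<^sup>+ \<xi>. e k \<xi> \<partial>lborel) \<le> ennreal ((2 * pi) ^ DIM('a)) * energy g"
      unfolding e_def U_def energy_eq_lborel[OF g]
      by (intro exI allI impI nn_integral_gaussian_fourier_le[OF gi]) simp
  qed
  then have "ennreal (c\<^sup>2) * (\<integral>\<^sup>+ \<xi>. ennreal ((cmod (U \<xi>))\<^sup>2) \<partial>lborel)
      \<le> ennreal (c\<^sup>2) * (ennreal ((2 * pi) ^ DIM('a)) * energy g)"
    by (intro mult_left_mono) simp_all
  also have "\<dots> = energy g"
    unfolding mult.assoc[symmetric]
    by (subst ennreal_mult'[symmetric]) (simp_all only: c zero_le_power2 ennreal_1 mult_1_left)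
  also have "energy g = energy f"
    using eq by (intro energy_cong_AE) auto
  also have "ennreal (c\<^sup>2) * (\<integral>\<^sup>+ \<xi>. ennreal ((cmod (U \<xi>))\<^sup>2) \<partial>lborel) = energy (fourier_integral f)"
    unfolding energy_eq_lborel[OF fourier_integral_measurable[OF fm]]
    by (subst nn_integral_cmult[symmetric])
       (simp_all add: FI norm_mult power_mult_distrib ennreal_mult)
  finally show ?thesis .
qed

section \<open>Sup bound for L1 data and extension of the energy bound to L2\<close>

lemma cmod_fourier_integral_le:
  fixes f :: "'a::euclidean_space \<Rightarrow> complex"
  assumes f: "f \<in> L1"
  shows "ennreal (cmod (fourier_integral f \<xi>)) \<le> norm_L1 f"
proof -
  have e: "(\<lambda>x. exp (- \<i> * of_real (x \<bullet> \<xi>))) \<in> borel_measurable lebesgue"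
    by (rule measurable_completion) simp
  have nexp: "cmod (exp (- \<i> * of_real r)) = 1" for r
    by (simp add: norm_exp_eq_Re)
  have int: "integrable lebesgue (\<lambda>x. exp (- \<i> * of_real (x \<bullet> \<xi>)) * f x)"
    by (rule Bochner_Integration.integrable_bound[OF L1_imp_integrable[OF f]])
       (use L1_imp_integrable[OF f] e in \<open>auto simp: norm_mult nexp\<close>)
  \<comment> \<open>The normalising constant is at most 1, which gives the sup bound with constant
    1.\<close>
  have "(2 * pi) powr (- real DIM('a) / 2) \<le> (2 * pi) powr 0"
    using pi_ge_two by (intro powr_mono) auto
  then have "cmod (fourier_integral f \<xi>) \<le> cmod (LINT x|lebesgue. exp (- \<i> * of_real (x \<bullet> \<xi>)) * f x)"
    unfolding fourier_integral_def norm_mult by (intro mult_left_le_one_le) auto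
  then have "ennreal (cmod (fourier_integral f \<xi>)) \<le> ennreal (cmod (LINT x|lebesgue. exp (- \<i> * of_real (x \<bullet> \<xi>)) * f x))"
    by (rule ennreal_leI)
  also have "\<dots> \<le> (\<integral>\<^sup>+ x. ennreal (cmod (exp (- \<i> * of_real (x \<bullet> \<xi>)) * f x)) \<partial>lebesgue)"
    by (rule integral_norm_bound_ennreal[OF int])
  also have "\<dots> = norm_L1 f" by (simp add: norm_L1_def norm_mult nexp)
  finally show ?thesis .
qed

text \<open>On a ball, which has finite measure, |f| \<le> 1 + |f|^2 suffices. This makes the
  Plancherel inequality available for the truncations that define the transform on L2.\<close>

lemma truncation_in_L1:
  fixes f :: "'a::euclidean_space \<Rightarrow> complex"
  assumes f: "f \<in> L2"
  shows "(\<lambda>x. indicator (ball 0 R) x * f x) \<in> L1"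
proof -
  have [measurable]: "f \<in> borel_measurable lebesgue" using f by (simp add: L2_def)
  have [measurable]: "ball (0::'a) R \<in> sets lebesgue" by simp
  have "norm_L1 (\<lambda>x. indicator (ball 0 R) x * f x)
      \<le> (\<integral>\<^sup>+ x. indicator (ball 0 R) x + ennreal ((cmod (f x))\<^sup>2) \<partial>lebesgue)"
    unfolding norm_L1_def
  proof (rule nn_integral_mono)
    fix x
    have "cmod (f x) \<le> 1 + (cmod (f x))\<^sup>2"
      using sum_squares_bound[of 1 "cmod (f x)"] by (simp add: power2_eq_square) (smt (verit) norm_ge_zero)
    then have "ennreal (cmod (f x)) \<le> ennreal (1 + (cmod (f x))\<^sup>2)" by (rule ennreal_leI)
    then show "ennreal (cmod (indicator (ball 0 R) x * f x)) \<le> indicator (ball 0 R) x + ennreal ((cmod (f x))\<^sup>2)"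
      by (auto simp: indicator_def ennreal_plus)
  qed
  also have "\<dots> = emeasure lebesgue (ball (0::'a) R) + energy f"
    unfolding energy_def by (subst nn_integral_add) (auto intro: measurable_completion)
  also have "\<dots> < \<infinity>"
    using L2_energy_finite[OF f] emeasure_lborel_ball_finite[of "0::'a" R] by simp
  finally show ?thesis by (simp add: L1_def)
qed

text \<open>Outside L1 the transform is an L2 limit of transforms of truncations, whose energies are
  bounded by that of f. The factor 2 is the price of splitting F by the inequality for |a + b|^2; it
  only affects constants.\<close>

theorem energy_fourier_transform_le:
  fixes f :: "'a::euclidean_space \<Rightarrow> complex"
  assumes f: "f \<in> L2" and F: "fourier_transform f F"
  shows "energy F \<le> 2 * energy f"
proof (cases "f \<in> L1")
  case True
  then have "energy F = energy (fourier_integral f)"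
    using F by (intro energy_cong_AE) (simp add: fourier_transform_def)
  also have "\<dots> \<le> energy f" by (rule energy_fourier_integral_le[OF True])
  also have "\<dots> \<le> 2 * energy f" using mult_right_mono[of 1 2 "energy f"] by simp
  finally show ?thesis .
next
  case False
  define T where "T R x = indicator (ball 0 R) x * f x" for R and x :: 'a
  have Fm [measurable]: "F \<in> borel_measurable lebesgue" using F by (simp add: fourier_transform_def)
  have lim: "((\<lambda>R. norm_L2 (\<lambda>\<xi>. F \<xi> - fourier_integral (T R) \<xi>)) \<longlongrightarrow> 0) at_top"
    using F False by (simp add: fourier_transform_def T_def[abs_def])
  have T: "T R \<in> L1" for R unfolding T_def by (rule truncation_in_L1[OF f])
  have Tm: "fourier_integral (T R) \<in> borel_measurable lebesgue" for R
    using T[of R] by (auto simp: L1_def intro!: measurable_completion fourier_integral_measurable)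
  have le: "energy F \<le> 2 * (norm_L2 (\<lambda>\<xi>. F \<xi> - fourier_integral (T R) \<xi>))\<^sup>2 + 2 * energy f" for R
  proof -
    have "energy F \<le> 2 * energy (\<lambda>\<xi>. F \<xi> - fourier_integral (T R) \<xi>) + 2 * energy (fourier_integral (T R))"
      using energy_add_le[OF borel_measurable_diff[OF Fm Tm[of R]] Tm[of R]] by simp
    also have "energy (fourier_integral (T R)) \<le> energy (T R)"
      by (rule energy_fourier_integral_le[OF T])
    also have "energy (T R) \<le> energy f"
      by (rule energy_mono) (simp add: T_def indicator_def)
    finally show ?thesis
      by (simp add: norm_L2_square add_left_mono mult_left_mono)
  qed
  have "((\<lambda>R. 2 * (norm_L2 (\<lambda>\<xi>. F \<xi> - fourier_integral (T R) \<xi>))\<^sup>2 + 2 * energy f)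
      \<longlongrightarrow> 2 * 0\<^sup>2 + 2 * energy f) at_top"
    unfolding power2_eq_square
    by (intro tendsto_add tendsto_const ennreal_tendsto_cmult tendsto_mult_ennreal lim) auto
  then have "((\<lambda>R. 2 * (norm_L2 (\<lambda>\<xi>. F \<xi> - fourier_integral (T R) \<xi>))\<^sup>2 + 2 * energy f)
      \<longlongrightarrow> 2 * energy f) at_top" by simp
  then show ?thesis
    by (rule tendsto_lowerbound) (simp_all add: le)
qed

section \<open>Polar coordinates and upper bounds for the radial integral\<close>

text \<open>The image of Lebesgue measure under the norm has density n times the unit ball volume
  times r^(n-1). Both measures agree on the half-lines {..a}, where they give the volume of a ball;
  these are closed under intersection, generate the Borel sets and exhaust the line with finite
  measure.\<close>

lemma nn_integral_radial:
  fixes \<phi> :: "real \<Rightarrow> ennreal"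
  assumes [measurable]: "\<phi> \<in> borel_measurable borel"
  defines "n \<equiv> DIM('a::euclidean_space)"
  shows "(\<integral>\<^sup>+ x. \<phi> (norm (x::'a)) \<partial>lborel) =
    (\<integral>\<^sup>+ r. ennreal (real n * unit_ball_vol n * r ^ (n - 1)) * indicator {0..} r * \<phi> r \<partial>lborel)"
proof -
  define K where "K = real n * unit_ball_vol n"
  have K: "K \<ge> 0" by (simp add: K_def)
  define w where "w r = ennreal (K * r ^ (n - 1)) * indicator {0..} r" for r :: real
  have [measurable]: "w \<in> borel_measurable borel" unfolding w_def by measurable
  define M where "M = distr (lborel :: 'a measure) borel norm"
  have eqA: "emeasure M {..a} = emeasure (density lborel w) {..a}" and fin: "emeasure M {..a} \<noteq> \<infinity>" for a
  proof -
    have "emeasure M {..a} = emeasure lborel (cball (0::'a) a)"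
      unfolding M_def by (subst emeasure_distr) (auto intro!: arg_cong[where f="emeasure lborel"])
    moreover have "emeasure (density lborel w) {..a} = (\<integral>\<^sup>+ r. ennreal (K * r ^ (n - 1)) * indicator {0..a} r \<partial>lborel)"
      by (subst emeasure_density) (auto simp: w_def indicator_def intro!: nn_integral_cong)
    moreover have "emeasure lborel (cball (0::'a) a) = (\<integral>\<^sup>+ r. ennreal (K * r ^ (n - 1)) * indicator {0..a} r \<partial>lborel)"
    proof (cases "a \<ge> 0")
      case True
      have "(\<integral>\<^sup>+ r. ennreal (K * r ^ (n - 1)) * indicator {0..a} r \<partial>lborel)
          = ennreal (unit_ball_vol n * a ^ n - unit_ball_vol n * 0 ^ n)"
        using True K by (intro nn_integral_FTC_Icc) (auto simp: K_def intro!: derivative_eq_intros)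
      then show "emeasure lborel (cball (0::'a) a) = (\<integral>\<^sup>+ r. ennreal (K * r ^ (n - 1)) * indicator {0..a} r \<partial>lborel)"
        by (simp add: emeasure_cball[OF True] n_def zero_power)
    qed simp_all
    moreover have "emeasure lborel (cball (0::'a) a) \<noteq> \<infinity>"
      using emeasure_lborel_cball_finite[of "0::'a" a] by simp
    ultimately show "emeasure M {..a} = emeasure (density lborel w) {..a}" "emeasure M {..a} \<noteq> \<infinity>"
      by simp_all
  qed
  have "M = density lborel w"
  proof (rule measure_eqI_generator_eq[where \<Omega>=UNIV and E="range atMost" and A="\<lambda>i. {..real i}"])
    show "Int_stable (range (atMost :: real \<Rightarrow> _))"
      by (auto simp: Int_stable_def)
    show "sets M = sigma_sets UNIV (range atMost)"
      by (simp add: M_def borel_eq_atMost)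
    show "sets (density lborel w) = sigma_sets UNIV (range atMost)"
      by (simp add: borel_eq_atMost)
    show "(\<Union>i::nat. {..real i}) = UNIV"
      using real_arch_simple by auto
  qed (use fin in \<open>auto simp: eqA\<close>)
  moreover have "(\<integral>\<^sup>+ x. \<phi> (norm (x::'a)) \<partial>lborel) = (\<integral>\<^sup>+ r. \<phi> r \<partial>M)"
    unfolding M_def by (subst nn_integral_distr) simp_all
  ultimately have "(\<integral>\<^sup>+ x. \<phi> (norm (x::'a)) \<partial>lborel) = (\<integral>\<^sup>+ r. w r * \<phi> r \<partial>lborel)"
    by (simp add: nn_integral_density)
  then show ?thesis unfolding w_def K_def .
qed

text \<open>The radial part of the integral of sin^2(|\<xi>| t) |\<xi>|^(-2-2s) over the ball of
  radius \<delta>: the factor r^(n-1) from the spheres leaves r^(q-1) with q = n - 2 - 2s.\<close>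

definition sin_mass :: "real \<Rightarrow> real \<Rightarrow> real \<Rightarrow> ennreal" where
  "sin_mass q \<delta> t = (\<integral>\<^sup>+ r. ennreal ((sin (r * t))\<^sup>2 * r powr (q - 1)) * indicator {0<..<\<delta>} r \<partial>lborel)"

section \<open>Power integrals and upper bounds for the one-dimensional mass\<close>

lemma nn_integral_powr_from_0_le:
  fixes p c :: real
  assumes "p > -1" "c \<ge> 0"
  shows "(\<integral>\<^sup>+ r. ennreal (r powr p) * indicator {0<..<c} r \<partial>lborel) \<le> ennreal (c powr (p + 1) / (p + 1))"
proof -
  have "(\<integral>\<^sup>+ r. ennreal (r powr p) * indicator {0<..<c} r \<partial>lborel)
      \<le> (\<integral>\<^sup>+ r. ennreal (indicator {0..c} r * r powr p) \<partial>lborel)"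
    by (intro nn_integral_mono) (auto simp: indicator_def)
  also have "\<dots> = ennreal (c powr (p + 1) / (p + 1))"
    using nn_integral_has_integral_lebesgue[OF _ has_integral_powr_from_0[OF assms]] by simp
  finally show ?thesis .
qed

lemma nn_integral_powr_Icc:
  fixes q a b :: real
  assumes "q \<noteq> 0" "0 < a" "a \<le> b"
  shows "(\<integral>\<^sup>+ r. ennreal (r powr (q - 1)) * indicator {a..b} r \<partial>lborel) = ennreal ((b powr q - a powr q) / q)"
proof -
  have "(\<integral>\<^sup>+ r. ennreal (r powr (q - 1)) * indicator {a..b} r \<partial>lborel)
      = ennreal (b powr q / q - a powr q / q)"
    using assms by (intro nn_integral_FTC_Icc) (auto intro!: derivative_eq_intros)
  then show ?thesis by (simp add: diff_divide_distrib)
qed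

lemma nn_integral_inverse_Icc:
  fixes a b :: real
  assumes "0 < a" "a \<le> b"
  shows "(\<integral>\<^sup>+ r. ennreal (r powr (- 1)) * indicator {a..b} r \<partial>lborel) = ennreal (ln b - ln a)"
  using assms
  by (intro nn_integral_FTC_Icc) (auto intro!: derivative_eq_intros simp: powr_minus_divide)

text \<open>The frequency 1/t separates the regimes: below it sin^2(r t) \<le> (r t)^2, above it
  sin^2 \<le> 1. The condition q > -2 makes r^(q+1) integrable at 0.\<close>

lemma sin_mass_le_split:
  assumes "t > 0" "1 / t \<le> 1" "q > -2"
  shows "sin_mass q 1 t \<le> ennreal (t powr (- q) / (q + 2))
    + (\<integral>\<^sup>+ r. ennreal (r powr (q - 1)) * indicator {1/t..1} r \<partial>lborel)"
proof -
  have le: "ennreal ((sin (r * t))\<^sup>2 * r powr (q - 1)) * indicator {0<..<1} r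
      \<le> ennreal (t\<^sup>2) * (ennreal (r powr (q + 1)) * indicator {0<..<1/t} r)
        + ennreal (r powr (q - 1)) * indicator {1/t..1} r" for r
  proof (cases "0 < r \<and> r < 1 / t")
    case True
    have "(sin (r * t))\<^sup>2 \<le> (r * t)\<^sup>2"
      using abs_sin_x_le_abs_x[of "r * t"] by (simp add: abs_le_square_iff)
    then have "(sin (r * t))\<^sup>2 * r powr (q - 1) \<le> (r * t)\<^sup>2 * r powr (q - 1)"
      by (rule mult_right_mono) simp
    also have "\<dots> = t\<^sup>2 * (r powr 2 * r powr (q - 1))"
      using True by (simp add: power_mult_distrib)
    also have "\<dots> = t\<^sup>2 * r powr (q + 1)"
      by (subst powr_add[symmetric]) (simp add: add.commute)
    finally show ?thesis
      using True assms by (simp add: indicator_def ennreal_mult[symmetric] ennreal_leI)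
  next
    case False
    have "(sin (r * t))\<^sup>2 * r powr (q - 1) \<le> 1 * r powr (q - 1)"
      by (intro mult_right_mono) (simp_all add: abs_square_le_1)
    then show ?thesis
      using False by (auto simp: indicator_def ennreal_leI)
  qed
  have "sin_mass q 1 t \<le> (\<integral>\<^sup>+ r. ennreal (t\<^sup>2) * (ennreal (r powr (q + 1)) * indicator {0<..<1/t} r)
        + ennreal (r powr (q - 1)) * indicator {1/t..1} r \<partial>lborel)"
    unfolding sin_mass_def by (intro nn_integral_mono le)
  also have "\<dots> = ennreal (t\<^sup>2) * (\<integral>\<^sup>+ r. ennreal (r powr (q + 1)) * indicator {0<..<1/t} r \<partial>lborel)
        + (\<integral>\<^sup>+ r. ennreal (r powr (q - 1)) * indicator {1/t..1} r \<partial>lborel)"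
    by (simp add: nn_integral_add nn_integral_cmult)
  also have "ennreal (t\<^sup>2) * (\<integral>\<^sup>+ r. ennreal (r powr (q + 1)) * indicator {0<..<1/t} r \<partial>lborel)
      \<le> ennreal (t\<^sup>2) * ennreal ((1 / t) powr (q + 1 + 1) / (q + 1 + 1))"
    using assms by (intro mult_left_mono nn_integral_powr_from_0_le) auto
  also have "\<dots> = ennreal (t\<^sup>2 * (1 / t) powr (q + 2) / (q + 2))"
    using assms by (simp add: ennreal_mult'[symmetric] add.assoc)
  also have "t\<^sup>2 * (1 / t) powr (q + 2) = t powr (- q)"
  proof -
    have "t\<^sup>2 * (1 / t) powr (q + 2) = t powr 2 * t powr (- (q + 2))"
      using assms by (simp add: powr_divide powr_minus_divide[of t "q + 2", simplified])
    then show ?thesis by (simp add: powr_add[symmetric])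
  qed
  finally show ?thesis by simp
qed

text \<open>The square of D in terms of q = n - 2 - 2s; see \<open>D_square\<close>.\<close>

definition growth :: "real \<Rightarrow> real \<Rightarrow> real" where
  "growth q t = (if q < 0 then t powr (- q) else if q = 0 then ln t else 1)"

lemma growth_nonneg: "t \<ge> 1 \<Longrightarrow> growth q t \<ge> 0"
  by (simp add: growth_def)

text \<open>The threshold exp 1 is where the logarithm reaches 1. From there on, terms that do not
  depend on t can be absorbed into the growth.\<close>

lemma growth_ge_1: "t \<ge> exp 1 \<Longrightarrow> growth q t \<ge> 1"
proof -
  assume t: "t \<ge> exp 1"
  have "t \<ge> 1" using t one_le_exp_iff[of 1] by linarith
  moreover have "ln t \<ge> 1" using t by (metis exp_gt_zero exp_ln_iff exp_le_cancel_iff order_less_le_trans)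
  ultimately show ?thesis by (simp add: growth_def ge_one_powr_ge_zero)
qed

text \<open>For q < 0 the frequencies around 1/t dominate. For q = 0 all scales between 1/t and 1
  contribute alike, whence the logarithm. For q > 0 the weight is integrable at 0 and sin^2 \<le> 1
  is enough.\<close>

lemma sin_mass_upper:
  assumes q: "q > -2"
  shows "\<exists>C>0. \<forall>t\<ge>exp 1. sin_mass q 1 t \<le> ennreal (C * growth q t)"
proof -
  have t: "t > 0" "1 / t \<le> 1" "ln t \<ge> 1" "t \<ge> 1" if "t \<ge> exp 1" for t :: real
  proof -
    show "t \<ge> 1" using that one_le_exp_iff[of 1] by linarith
    then show "t > 0" "1 / t \<le> 1" by auto
    show "ln t \<ge> 1" using that by (metis exp_gt_zero exp_ln_iff exp_le_cancel_iff order_less_le_trans)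
  qed
  consider "q < 0" | "q = 0" | "q > 0" by linarith
  then show ?thesis
  proof cases
    case 1
    \<comment> \<open>The summand 1 / (q + 2) comes from the frequencies below 1/t and 1 / (- q)
      from those above, after dropping the negative term 1 / q.\<close>
    show ?thesis
    proof (intro exI[of _ "1 / (q + 2) + 1 / (- q)"] conjI allI impI)
      show "0 < 1 / (q + 2) + 1 / (- q)" using 1 q by (intro add_pos_pos) auto
      fix t :: real assume tt: "t \<ge> exp 1"
      note t = t[OF tt]
      have inv: "(1 / t) powr q = t powr (- q)" using t by (simp add: powr_divide powr_minus_divide)
      have "sin_mass q 1 t \<le> ennreal (t powr (- q) / (q + 2)) + ennreal ((1 - t powr (- q)) / q)"
        using sin_mass_le_split[OF t(1,2) q] nn_integral_powr_Icc[of q "1/t" 1] 1 t by (simp add: inv)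
      also have "(1 - t powr (- q)) / q \<le> t powr (- q) / (- q)"
      proof -
        have "(1 - t powr (- q)) / q = 1 / q + t powr (- q) / (- q)"
          by (simp add: diff_divide_distrib)
        then show ?thesis using 1 by (simp add: divide_le_0_iff)
      qed
      also have "ennreal (t powr (- q) / (q + 2)) + ennreal (t powr (- q) / (- q))
          = ennreal (t powr (- q) / (q + 2) + t powr (- q) / (- q))"
        using 1 q by (intro ennreal_plus[symmetric]) (auto simp: divide_le_0_iff)
      also have "t powr (- q) / (q + 2) + t powr (- q) / (- q) = (1 / (q + 2) + 1 / (- q)) * growth q t"
        using 1 by (simp add: growth_def field_simps)
      finally show "sin_mass q 1 t \<le> ennreal ((1 / (q + 2) + 1 / (- q)) * growth q t)"
        by (simp add: add_left_mono ennreal_leI)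
    qed
  next
    case 2
    show ?thesis
    proof (intro exI[of _ 2] conjI allI impI)
      fix t :: real assume tt: "t \<ge> exp 1"
      note t = t[OF tt]
      have "sin_mass q 1 t \<le> ennreal (1 / 2) + ennreal (ln t)"
        using sin_mass_le_split[OF t(1,2) q] nn_integral_inverse_Icc[of "1/t" 1] 2 t by (simp add: ln_div)
      also have "\<dots> = ennreal (1 / 2 + ln t)"
        using t by (intro ennreal_plus[symmetric]) auto
      also have "\<dots> \<le> ennreal (2 * growth q t)"
        using t 2 by (intro ennreal_leI) (simp add: growth_def)
      finally show "sin_mass q 1 t \<le> ennreal (2 * growth q t)" .
    qed simp
  next
    case 3
    show ?thesis
    proof (intro exI[of _ "1 / q"] conjI allI impI)
      fix t :: real
      have "sin_mass q 1 t \<le> (\<integral>\<^sup>+ r. ennreal (r powr (q - 1)) * indicator {0<..<1} r \<partial>lborel)"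
        unfolding sin_mass_def
      proof (intro nn_integral_mono mult_right_mono ennreal_leI)
        fix r
        have "(sin (r * t))\<^sup>2 * r powr (q - 1) \<le> 1 * r powr (q - 1)"
          by (intro mult_right_mono) (simp_all add: abs_square_le_1)
        then show "(sin (r * t))\<^sup>2 * r powr (q - 1) \<le> r powr (q - 1)" by simp
      qed simp
      also have "\<dots> \<le> ennreal (1 / q * growth q t)"
        using nn_integral_powr_from_0_le[of "q - 1" 1] 3 by (simp add: growth_def)
      finally show "sin_mass q 1 t \<le> ennreal (1 / q * growth q t)" .
    qed (use 3 in simp)
  qed
qed

section \<open>Lower bounds for the radial integral\<close>

text \<open>Shifting by a quarter period turns \<open>sin\<^sup>2\<close> into \<open>cos\<^sup>2\<close>; against a decreasing weight
  the shift only decreases the integral, and \<open>sin\<^sup>2 + cos\<^sup>2 = 1\<close>.\<close>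

lemma nn_integral_sin_square_ge:
  fixes f :: "real \<Rightarrow> real"
  assumes [measurable]: "f \<in> borel_measurable borel"
    and nonneg: "\<And>r. f r \<ge> 0" and anti: "\<And>x y. 0 < x \<Longrightarrow> x \<le> y \<Longrightarrow> f y \<le> f x"
    and t: "t > 0" and a: "a \<ge> 0"
  shows "(\<integral>\<^sup>+ r. ennreal (f r) * indicator {a + pi / (2 * t)<..<b} r \<partial>lborel)
    \<le> 2 * (\<integral>\<^sup>+ r. ennreal ((sin (r * t))\<^sup>2 * f r) * indicator {a<..<b} r \<partial>lborel)"
proof -
  define h where "h = pi / (2 * t)"
  have h: "h > 0" using t by (simp add: h_def)
  define I where "I = (\<integral>\<^sup>+ r. ennreal ((sin (r * t))\<^sup>2 * f r) * indicator {a<..<b} r \<partial>lborel)"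
  have "(\<integral>\<^sup>+ r. ennreal ((sin (r * t))\<^sup>2 * f r) * indicator {a + h<..<b} r \<partial>lborel) \<le> I"
    unfolding I_def by (intro nn_integral_mono) (use h in \<open>auto simp: indicator_def\<close>)
  moreover have "(\<integral>\<^sup>+ r. ennreal ((cos (r * t))\<^sup>2 * f r) * indicator {a + h<..<b} r \<partial>lborel) \<le> I"
  proof -
    have c: "(sin ((r - h) * t))\<^sup>2 = (cos (r * t))\<^sup>2" for r
    proof -
      have "(r - h) * t = r * t - pi / 2" using t by (simp add: h_def field_simps)
      then show ?thesis by (simp add: sin_diff)
    qed
    have "(\<integral>\<^sup>+ r. ennreal ((cos (r * t))\<^sup>2 * f r) * indicator {a + h<..<b} r \<partial>lborel)
        \<le> (\<integral>\<^sup>+ r. ennreal ((sin ((- h + 1 * r) * t))\<^sup>2 * f (- h + 1 * r)) * indicator {a<..<b} (- h + 1 * r) \<partial>lborel)"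
    proof (rule nn_integral_mono)
      fix r
      show "ennreal ((cos (r * t))\<^sup>2 * f r) * indicator {a + h<..<b} r
          \<le> ennreal ((sin ((- h + 1 * r) * t))\<^sup>2 * f (- h + 1 * r)) * indicator {a<..<b} (- h + 1 * r)"
      proof (cases "a + h < r \<and> r < b")
        case True
        then have "f r \<le> f (r - h)" using a h by (intro anti) auto
        then show ?thesis using True h c[of r] by (auto simp: indicator_def intro!: ennreal_leI mult_left_mono)
      qed (auto simp: indicator_def)
    qed
    also have "\<dots> = I"
      unfolding I_def
      by (subst nn_integral_real_affine[where c=1 and t="- h"
            and f="\<lambda>r. ennreal ((sin (r * t))\<^sup>2 * f r) * indicator {a<..<b} r"]) simp_all
    finally show ?thesis .
  qed
  ultimately have "(\<integral>\<^sup>+ r. ennreal ((sin (r * t))\<^sup>2 * f r) * indicator {a + h<..<b} r \<partial>lborel)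
      + (\<integral>\<^sup>+ r. ennreal ((cos (r * t))\<^sup>2 * f r) * indicator {a + h<..<b} r \<partial>lborel) \<le> I + I"
    by (rule add_mono)
  moreover have "(\<integral>\<^sup>+ r. ennreal ((sin (r * t))\<^sup>2 * f r) * indicator {a + h<..<b} r \<partial>lborel)
      + (\<integral>\<^sup>+ r. ennreal ((cos (r * t))\<^sup>2 * f r) * indicator {a + h<..<b} r \<partial>lborel)
      = (\<integral>\<^sup>+ r. ennreal (f r) * indicator {a + h<..<b} r \<partial>lborel)"
  proof -
    have "ennreal ((sin (r * t))\<^sup>2 * f r) * i + ennreal ((cos (r * t))\<^sup>2 * f r) * i = ennreal (f r) * i"
      for r and i :: ennreal
    proof -
      have "(sin (r * t))\<^sup>2 * f r + (cos (r * t))\<^sup>2 * f r = f r"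
        unfolding distrib_right[symmetric] by simp
      then have "ennreal ((sin (r * t))\<^sup>2 * f r) + ennreal ((cos (r * t))\<^sup>2 * f r) = ennreal (f r)"
        using nonneg[of r] by (metis ennreal_plus mult_nonneg_nonneg zero_le_power2)
      then show ?thesis by (simp only: distrib_right[symmetric])
    qed
    then show ?thesis by (subst nn_integral_add[symmetric]) simp_all
  qed
  ultimately show ?thesis unfolding I_def h_def mult_2 by (simp only:)
qed

text \<open>For q \<le> 1 the weight r^(q-1) is decreasing, so the quarter-period shift applies with
  a = 0 and only the first quarter period is lost. The closed interval differs by a null set and
  fits the explicit power integrals.\<close>

lemma sin_mass_ge_nonpos:
  assumes q: "q \<le> 1" and t: "t > 0"
  shows "(\<integral>\<^sup>+ r. ennreal (r powr (q - 1)) * indicator {pi / (2 * t)..\<delta>} r \<partial>lborel) \<le> 2 * sin_mass q \<delta> t"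
proof -
  have "(\<integral>\<^sup>+ r. ennreal (r powr (q - 1)) * indicator {0 + pi / (2 * t)<..<\<delta>} r \<partial>lborel) \<le> 2 * sin_mass q \<delta> t"
    unfolding sin_mass_def using q t
    by (intro nn_integral_sin_square_ge powr_mono2') auto
  moreover have "(\<integral>\<^sup>+ r. ennreal (r powr (q - 1)) * indicator {pi / (2 * t)..\<delta>} r \<partial>lborel)
      = (\<integral>\<^sup>+ r. ennreal (r powr (q - 1)) * indicator {0 + pi / (2 * t)<..<\<delta>} r \<partial>lborel)"
  proof (rule nn_integral_cong_AE)
    have "AE r in lborel. r \<noteq> pi / (2 * t)" "AE r in lborel. r \<noteq> \<delta>" by (rule AE_lborel_singleton)+
    then show "AE r in lborel. ennreal (r powr (q - 1)) * indicator {pi / (2 * t)..\<delta>} r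
        = ennreal (r powr (q - 1)) * indicator {0 + pi / (2 * t)<..<\<delta>} r"
      by eventually_elim (auto simp: indicator_def)
  qed
  ultimately show ?thesis by simp
qed

lemma ennreal_le_two_mult_imp:
  assumes "ennreal a \<le> 2 * x"
  shows "ennreal (a / 2) \<le> x"
proof (cases x)
  case (real y)
  with assms have "ennreal a \<le> ennreal (2 * y)" by (simp add: ennreal_mult)
  then show ?thesis using real by (simp add: ennreal_le_iff)
qed simp

lemma powr_at_top:
  fixes p :: real
  assumes "p > 0"
  shows "filterlim (\<lambda>t::real. t powr p) at_top at_top"
proof -
  have "filterlim (\<lambda>t::real. exp (p * ln t)) at_top at_top"
    by (rule filterlim_compose[OF exp_at_top filterlim_tendsto_pos_mult_at_top[OF tendsto_const assms ln_at_top]])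
  moreover have "eventually (\<lambda>t::real. exp (p * ln t) = t powr p) at_top"
    using eventually_gt_at_top[of 0] by eventually_elim (simp add: powr_def)
  ultimately show ?thesis by (simp cong: filterlim_cong)
qed

text \<open>The power integral over [pi / (2t), \<delta>] owes its growth to the lower endpoint. The
  endpoint \<delta> contributes a constant, which half of the main term absorbs once t is
  large.\<close>

lemma sin_mass_lower_nonpos:
  assumes q: "q \<le> 0" and \<delta>: "\<delta> > 0"
  shows "\<exists>\<kappa>>0. eventually (\<lambda>t. ennreal (\<kappa> * growth q t) \<le> sin_mass q \<delta> t) at_top"
proof -
  have ev: "eventually (\<lambda>t. t \<ge> 1 \<and> t \<ge> pi / (2 * \<delta>)) at_top"
    by (intro eventually_conj eventually_ge_at_top)
  show ?thesis
  proof (cases "q = 0")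
    case True
    \<comment> \<open>The integral equals ln t + ln (2 \<delta> / pi). This threshold keeps it above
      half of ln t, and the loss of 1/2 in \<open>sin_mass_ge_nonpos\<close> turns that into
      1/4.\<close>
    have "eventually (\<lambda>t. ln t \<ge> - 2 * ln (2 * \<delta> / pi)) at_top"
      using ln_at_top by (simp add: filterlim_at_top)
    with ev have "eventually (\<lambda>t. ennreal (1 / 4 * growth q t) \<le> sin_mass q \<delta> t) at_top"
    proof eventually_elim
      case (elim t)
      then have t: "t > 0" "pi / (2 * t) \<le> \<delta>" using \<delta> by (auto simp: field_simps)
      have "ennreal (ln \<delta> - ln (pi / (2 * t))) \<le> 2 * sin_mass q \<delta> t"
        using sin_mass_ge_nonpos[of q t \<delta>] nn_integral_inverse_Icc[of "pi / (2 * t)" \<delta>] True t by simp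
      then have "ennreal ((ln \<delta> - ln (pi / (2 * t))) / 2) \<le> sin_mass q \<delta> t"
        by (rule ennreal_le_two_mult_imp)
      moreover have "1 / 4 * growth q t \<le> (ln \<delta> - ln (pi / (2 * t))) / 2"
        using elim t \<delta> True by (simp add: growth_def ln_div ln_mult)
      ultimately show ?case using ennreal_leI order_trans by blast
    qed
    then show ?thesis by (intro exI[of _ "1 / 4"]) simp
  next
    case False
    with q have q: "q < 0" by simp
    define k where "k = (pi / 2) powr q"
    have k: "k > 0" by (simp add: k_def)
    have "filterlim (\<lambda>t. t powr (- q)) at_top at_top"
      using q by (intro powr_at_top) auto
    \<comment> \<open>The lower endpoint contributes \<open>k * t powr (- q)\<close>; from here on
      the term of \<delta> is at most half of it. This half and the one from
      \<open>sin_mass_ge_nonpos\<close> give the 4 in the constant.\<close>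
    then have "eventually (\<lambda>t. t powr (- q) \<ge> 2 * \<delta> powr q / k) at_top"
      by (simp add: filterlim_at_top)
    with ev have "eventually (\<lambda>t. ennreal (k / (4 * (- q)) * growth q t) \<le> sin_mass q \<delta> t) at_top"
    proof eventually_elim
      case (elim t)
      then have t: "t > 0" "pi / (2 * t) \<le> \<delta>" using \<delta> by (auto simp: field_simps)
      have h: "(pi / (2 * t)) powr q = k * t powr (- q)"
      proof -
        have "pi / (2 * t) = (pi / 2) / t" by simp
        then show ?thesis using t by (simp only: k_def powr_divide powr_minus_divide) simp
      qed
      have "ennreal ((\<delta> powr q - k * t powr (- q)) / q) \<le> 2 * sin_mass q \<delta> t"
        using sin_mass_ge_nonpos[of q t \<delta>] nn_integral_powr_Icc[of q "pi / (2 * t)" \<delta>] q t by (simp add: h)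
      then have 1: "ennreal ((\<delta> powr q - k * t powr (- q)) / q / 2) \<le> sin_mass q \<delta> t"
        by (rule ennreal_le_two_mult_imp)
      have "2 * \<delta> powr q \<le> k * t powr (- q)"
        using elim k by (simp add: field_simps)
      then have "k * t powr (- q) / 2 \<le> k * t powr (- q) - \<delta> powr q" by simp
      then have "k * t powr (- q) / 2 / (2 * (- q)) \<le> (k * t powr (- q) - \<delta> powr q) / (2 * (- q))"
        using q by (intro divide_right_mono) auto
      also have "\<dots> = (\<delta> powr q - k * t powr (- q)) / q / 2" using q by (simp add: field_simps)
      also have "k * t powr (- q) / 2 / (2 * (- q)) = k / (4 * (- q)) * growth q t"
        using q by (simp add: growth_def)
      finally show ?case using 1 ennreal_leI order_trans by blast
    qed
    moreover have "k / (4 * (- q)) > 0" using k q by (intro divide_pos_pos) auto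
    ultimately show ?thesis by blast
  qed
qed

text \<open>On (\<delta>/2, \<delta>) the weight is comparable to the constant \<delta>^(q-1), and a
  constant weight admits the quarter-period shift for every q. If t \<ge> 2 pi / \<delta>, the shift
  costs at most \<delta>/4 and an interval of length at least \<delta>/4 remains. That \<kappa> does
  not depend on \<delta> is essential, since \<delta> is chosen afterwards.\<close>

lemma sin_mass_lower_pos:
  assumes q: "q > 0"
  shows "\<exists>\<kappa>>0. \<forall>\<delta>>0. \<forall>t\<ge>2 * pi / \<delta>. ennreal (\<kappa> * \<delta> powr q) \<le> sin_mass q \<delta> t"
proof -
  \<comment> \<open>On (\<delta>/2, \<delta>) the infimum of r^(q-1) is at \<delta>/2 if q \<ge> 1
    and at \<delta> if q < 1; \<open>m\<close> covers both cases.\<close>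
  define m :: real where "m = min 1 ((1 / 2) powr (q - 1))"
  have m: "m > 0" by (simp add: m_def)
  have "ennreal (m / 8 * \<delta> powr q) \<le> sin_mass q \<delta> t" if \<delta>: "\<delta> > 0" and t: "t \<ge> 2 * pi / \<delta>" for \<delta> t
  proof -
    have t0: "t > 0" using \<delta> t pi_gt_zero by (meson divide_pos_pos less_le_trans mult_pos_pos zero_less_numeral)
    define f where "f = m * \<delta> powr (q - 1)"
    have f: "f \<ge> 0" using m by (simp add: f_def)
    have h: "pi / (2 * t) \<le> \<delta> / 4" using t t0 \<delta> by (simp add: field_simps)
    have ge: "f \<le> r powr (q - 1)" if "\<delta> / 2 < r" "r < \<delta>" for r
    proof (cases "q \<ge> 1")
      case True
      have "f \<le> (1 / 2) powr (q - 1) * \<delta> powr (q - 1)"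
        unfolding f_def by (intro mult_right_mono) (simp_all add: m_def)
      also have "\<dots> = (\<delta> / 2) powr (q - 1)" using \<delta> by (simp add: powr_mult[symmetric])
      also have "\<dots> \<le> r powr (q - 1)" using True that \<delta> by (intro powr_mono2) auto
      finally show ?thesis .
    next
      case False
      have "f \<le> 1 * \<delta> powr (q - 1)"
        unfolding f_def by (intro mult_right_mono) (simp_all add: m_def)
      also have "\<dots> \<le> r powr (q - 1)" using False that \<delta> by (simp add: powr_mono2')
      finally show ?thesis .
    qed
    have "ennreal (f * (\<delta> / 4)) \<le> ennreal f * ennreal (\<delta> - (\<delta> / 2 + pi / (2 * t)))"
    proof -
      have "f * (\<delta> / 4) \<le> f * (\<delta> - (\<delta> / 2 + pi / (2 * t)))"
        using h f by (intro mult_left_mono) linarith+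
      then show ?thesis using f by (subst ennreal_mult'[symmetric]) (auto intro: ennreal_leI)
    qed
    also have "\<dots> = (\<integral>\<^sup>+ r. ennreal f * indicator {\<delta> / 2 + pi / (2 * t)<..<\<delta>} r \<partial>lborel)"
      using h \<delta> by (simp add: nn_integral_cmult)
    also have "\<dots> \<le> 2 * (\<integral>\<^sup>+ r. ennreal ((sin (r * t))\<^sup>2 * f) * indicator {\<delta> / 2<..<\<delta>} r \<partial>lborel)"
      using t0 f \<delta> by (intro nn_integral_sin_square_ge) auto
    also have "(\<integral>\<^sup>+ r. ennreal ((sin (r * t))\<^sup>2 * f) * indicator {\<delta> / 2<..<\<delta>} r \<partial>lborel) \<le> sin_mass q \<delta> t"
      unfolding sin_mass_def
      by (intro nn_integral_mono) (use \<delta> ge in \<open>auto simp: indicator_def intro!: ennreal_leI mult_left_mono\<close>)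
    finally have "ennreal (f * (\<delta> / 4)) \<le> 2 * sin_mass q \<delta> t" by (simp add: mult_left_mono)
    then have "ennreal (f * (\<delta> / 4) / 2) \<le> sin_mass q \<delta> t" by (rule ennreal_le_two_mult_imp)
    moreover have "f * (\<delta> / 4) / 2 = m / 8 * \<delta> powr q"
      using \<delta> by (simp add: f_def powr_diff)
    ultimately show ?thesis by simp
  qed
  then show ?thesis using m by (intro exI[of _ "m / 8"]) auto
qed

text \<open>Near 0 one has sin(r t) \<ge> r t / 2, so the integrand is at least t^2/4 times r^(q+1).
  As q + 1 \<le> -1, for r < 1 this dominates t^2/4 times 1/r, and the logarithm diverges.\<close>

lemma sin_mass_infinite:
  assumes q: "q \<le> -2" and \<delta>: "\<delta> > 0" and t: "t > 0"
  shows "sin_mass q \<delta> t = \<infinity>"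
proof -
  \<comment> \<open>The cut-off \<open>b\<close> lies below 1 in order to compare powers of r, below
    \<delta> to stay in the range, and below 1/t so that r t \<le> 1; halving makes the inequalities
    strict.\<close>
  define m where "m = min 1 (min \<delta> (1 / t))"
  have m: "0 < m" "m \<le> 1" "m \<le> \<delta>" "m \<le> 1 / t" using \<delta> t by (auto simp: m_def)
  define b where "b = m / 2"
  have b: "0 < b" "b < 1" "b < \<delta>" "b < 1 / t" using m unfolding b_def by linarith+
  have sin_ge: "x / 2 \<le> sin x" if "0 \<le> x" "x \<le> 1" for x :: real
  proof -
    have "sin 0 - 0 / 2 \<le> sin x - x / 2"
    proof (rule DERIV_nonneg_imp_nondecreasing[OF that(1)])
      fix y :: real assume y: "0 \<le> y" "y \<le> x"
      \<comment> \<open>Since 1 < pi / 3, the derivative cos y - 1/2 stays nonnegative on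
        [0, 1].\<close>
      have "cos (pi / 3) \<le> cos y"
        using y that pi_gt3 by (intro cos_monotone_0_pi_le) auto
      then have "cos y - 1 / 2 \<ge> 0" by (simp add: cos_60)
      moreover have "((\<lambda>x. sin x - x / 2) has_real_derivative cos y - 1 / 2) (at y)"
        by (auto intro!: derivative_eq_intros)
      ultimately show "\<exists>d. ((\<lambda>x. sin x - x / 2) has_real_derivative d) (at y) \<and> 0 \<le> d" by blast
    qed
    then show ?thesis by simp
  qed
  have ge: "ennreal (t\<^sup>2 / 4 * r powr (- 1)) \<le> ennreal ((sin (r * t))\<^sup>2 * r powr (q - 1))"
    if r: "0 < r" "r \<le> b" for r
  proof (rule ennreal_leI)
    have rt: "r * t \<le> 1" using r b t by (simp add: field_simps) (smt (verit) mult_right_mono)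
    have "t\<^sup>2 / 4 * r powr (- 1) \<le> t\<^sup>2 / 4 * r powr (2 + (q - 1))"
      using r b q by (intro mult_left_mono powr_mono') auto
    also have "\<dots> = (r * t / 2)\<^sup>2 * r powr (q - 1)"
      using r by (simp only: powr_add) (simp add: power_mult_distrib power_divide)
    also have "\<dots> \<le> (sin (r * t))\<^sup>2 * r powr (q - 1)"
      using sin_ge[OF _ rt] r t by (intro mult_right_mono power_mono) auto
    finally show "t\<^sup>2 / 4 * r powr (- 1) \<le> (sin (r * t))\<^sup>2 * r powr (q - 1)" .
  qed
  have lower: "ennreal (t\<^sup>2 / 4 * (ln b - ln a)) \<le> sin_mass q \<delta> t" if a: "0 < a" "a \<le> b" for a
  proof -
    have "ennreal (t\<^sup>2 / 4 * (ln b - ln a)) = ennreal (t\<^sup>2 / 4) * (\<integral>\<^sup>+ r. ennreal (r powr (- 1)) * indicator {a..b} r \<partial>lborel)"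
      unfolding nn_integral_inverse_Icc[OF a] by (rule ennreal_mult') simp
    also have "\<dots> = (\<integral>\<^sup>+ r. ennreal (t\<^sup>2 / 4 * r powr (- 1)) * indicator {a..b} r \<partial>lborel)"
    proof -
      have "ennreal (t\<^sup>2 / 4 * r powr (- 1)) = ennreal (t\<^sup>2 / 4) * ennreal (r powr (- 1))" for r
        by (rule ennreal_mult') simp
      then show ?thesis
        by (simp only: mult.assoc) (rule nn_integral_cmult[symmetric], measurable)
    qed
    also have "\<dots> \<le> sin_mass q \<delta> t"
      unfolding sin_mass_def
    proof (rule nn_integral_mono)
      fix r
      show "ennreal (t\<^sup>2 / 4 * r powr (- 1)) * indicator {a..b} r
          \<le> ennreal ((sin (r * t))\<^sup>2 * r powr (q - 1)) * indicator {0<..<\<delta>} r"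
        using ge[of r] a b by (auto simp: indicator_def)
    qed
    finally show ?thesis .
  qed
  have "ennreal (real k) \<le> sin_mass q \<delta> t" for k
  proof -
    \<comment> \<open>The solution of t^2/4 * ln (b / a) = k.\<close>
    define a where "a = b * exp (- (4 * real k / t\<^sup>2))"
    have a: "0 < a" "a \<le> b" using b by (auto simp: a_def)
    have "t\<^sup>2 / 4 * (ln b - ln a) = real k"
      using b t by (simp add: a_def ln_mult)
    with lower[OF a] show ?thesis by simp
  qed
  then show ?thesis
    using ennreal_Ex_less_of_nat[of "sin_mass q \<delta> t"]
    by (metis ennreal_of_nat_eq_real_of_nat infinity_ennreal_def leD top.not_eq_extremum)
qed

section \<open>Comparing the mass with the volume of the ball\<close>

lemma growth_at_top:
  assumes "q \<le> 0"
  shows "filterlim (growth q) at_top at_top"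
proof (cases "q = 0")
  case True
  then show ?thesis using ln_at_top by (simp add: growth_def[abs_def])
next
  case False
  then have "growth q = (\<lambda>t. t powr (- q))" using assms by (simp add: growth_def[abs_def])
  then show ?thesis using False assms by (simp add: powr_at_top)
qed

text \<open>For \<open>q > 0\<close> the mass does not grow, and the volume term is beaten by taking \<open>\<delta>\<close>
  small, since \<open>q\<close> is less than the dimension.\<close>

lemma sin_mass_dominates:
  assumes n: "q < n" and A: "A > 0" and B: "B \<ge> 0" and \<delta>0: "\<delta>0 > 0"
  shows "\<exists>\<delta>>0. \<delta> \<le> \<delta>0 \<and> (\<exists>c>0. eventually (\<lambda>t. ennreal (c * growth q t + B * \<delta> powr n) \<le> ennreal A * sin_mass q \<delta> t) at_top)"
proof (cases "q \<le> 0")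
  case True
  from sin_mass_lower_nonpos[OF True \<delta>0] obtain \<kappa> where \<kappa>: "\<kappa> > 0"
    and ev: "eventually (\<lambda>t. ennreal (\<kappa> * growth q t) \<le> sin_mass q \<delta>0 t) at_top" by blast
  \<comment> \<open>The growth tends to infinity here, so \<delta>0 itself serves: eventually half
    of the main term pays for the volume term.\<close>
  have "eventually (\<lambda>t. growth q t \<ge> 2 * B * \<delta>0 powr n / (A * \<kappa>)) at_top"
    using growth_at_top[OF True] by (simp add: filterlim_at_top)
  with ev have "eventually (\<lambda>t. ennreal (A * \<kappa> / 2 * growth q t + B * \<delta>0 powr n) \<le> ennreal A * sin_mass q \<delta>0 t) at_top"
  proof eventually_elim
    case (elim t)
    have "B * \<delta>0 powr n \<le> A * \<kappa> / 2 * growth q t"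
      using elim(2) A \<kappa> by (simp add: field_simps)
    then have "ennreal (A * \<kappa> / 2 * growth q t + B * \<delta>0 powr n) \<le> ennreal (A * (\<kappa> * growth q t))"
      by (intro ennreal_leI) simp
    also have "\<dots> = ennreal A * ennreal (\<kappa> * growth q t)" using A by (intro ennreal_mult') simp
    also have "\<dots> \<le> ennreal A * sin_mass q \<delta>0 t" using elim(1) by (intro mult_left_mono) simp_all
    finally show ?case .
  qed
  moreover have "A * \<kappa> / 2 > 0" using A \<kappa> by simp
  ultimately show ?thesis using \<delta>0 by blast
next
  case False
  then have q: "q > 0" by simp
  from sin_mass_lower_pos[OF q] obtain \<kappa> where \<kappa>: "\<kappa> > 0"
    and low: "\<And>\<delta> t. \<delta> > 0 \<Longrightarrow> t \<ge> 2 * pi / \<delta> \<Longrightarrow> ennreal (\<kappa> * \<delta> powr q) \<le> sin_mass q \<delta> t" by blast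
  \<comment> \<open>If \<delta>^(n-q) \<le> e, then B \<delta>^n is at most half of A \<kappa>
    \<delta>^q. With B + 1 in the denominator the quotient makes sense for B = 0 as well.\<close>
  define e where "e = A * \<kappa> / (2 * (B + 1))"
  have e: "e > 0" using A \<kappa> B by (simp add: e_def)
  define \<delta> where "\<delta> = min \<delta>0 (e powr (1 / (n - q)))"
  have \<delta>: "\<delta> > 0" "\<delta> \<le> \<delta>0" using \<delta>0 e by (auto simp: \<delta>_def)
  have "\<delta> powr (n - q) \<le> (e powr (1 / (n - q))) powr (n - q)"
    using n \<delta> by (intro powr_mono2) (auto simp: \<delta>_def)
  also have "\<dots> = e" using n e by (simp add: powr_powr)
  finally have "B * \<delta> powr (n - q) \<le> B * e" using B by (rule mult_left_mono)
  also have "\<dots> \<le> (B + 1) * e" using e by simp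
  also have "\<dots> = A * \<kappa> / 2"
    unfolding e_def using B by (simp only: times_divide_eq_right) (simp add: field_simps)
  finally have "B * \<delta> powr (n - q) * \<delta> powr q \<le> A * \<kappa> / 2 * \<delta> powr q"
    by (rule mult_right_mono) simp
  then have B': "B * \<delta> powr n \<le> A * \<kappa> / 2 * \<delta> powr q"
    by (simp add: mult.assoc powr_add[symmetric])
  have "eventually (\<lambda>t. ennreal (A * \<kappa> / 2 * \<delta> powr q * growth q t + B * \<delta> powr n) \<le> ennreal A * sin_mass q \<delta> t) at_top"
    using eventually_ge_at_top[of "2 * pi / \<delta>"]
  proof eventually_elim
    case (elim t)
    have "ennreal (A * \<kappa> / 2 * \<delta> powr q * growth q t + B * \<delta> powr n) \<le> ennreal (A * (\<kappa> * \<delta> powr q))"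
      using B' q by (intro ennreal_leI) (simp add: growth_def)
    also have "\<dots> = ennreal A * ennreal (\<kappa> * \<delta> powr q)" using A by (intro ennreal_mult') simp
    also have "\<dots> \<le> ennreal A * sin_mass q \<delta> t" using low[OF \<delta>(1) elim] by (intro mult_left_mono) simp_all
    finally show ?case .
  qed
  moreover have "A * \<kappa> / 2 * \<delta> powr q > 0" using A \<kappa> \<delta> by simp
  ultimately show ?thesis using \<delta> by blast
qed

section \<open>Energy of the wave multiplier\<close>

lemma nn_integral_ball_sin_mass:
  fixes s \<delta> t :: real
  defines "n \<equiv> DIM('a::euclidean_space)"
  shows "(\<integral>\<^sup>+ \<xi>. ennreal ((sin (norm \<xi> * t))\<^sup>2 * norm \<xi> powr (- 2 - 2 * s)) * indicator (ball (0::'a) \<delta>) \<xi> \<partial>lebesgue)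
    = ennreal (real n * unit_ball_vol n) * sin_mass (real n - 2 - 2 * s) \<delta> t"
proof -
  define \<phi> where "\<phi> r = ennreal ((sin (r * t))\<^sup>2 * r powr (- 2 - 2 * s)) * indicator {..<\<delta>} r" for r
  have [measurable]: "\<phi> \<in> borel_measurable borel" unfolding \<phi>_def by measurable
  have "(\<integral>\<^sup>+ \<xi>. ennreal ((sin (norm \<xi> * t))\<^sup>2 * norm \<xi> powr (- 2 - 2 * s)) * indicator (ball (0::'a) \<delta>) \<xi> \<partial>lebesgue)
      = (\<integral>\<^sup>+ \<xi>. \<phi> (norm (\<xi>::'a)) \<partial>lborel)"
    unfolding nn_integral_completion by (intro nn_integral_cong) (simp add: \<phi>_def indicator_def)
  also have "\<dots> = (\<integral>\<^sup>+ r. ennreal (real n * unit_ball_vol n * r ^ (n - 1)) * indicator {0..} r * \<phi> r \<partial>lborel)"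
    unfolding n_def by (rule nn_integral_radial) measurable
  also have "\<dots> = (\<integral>\<^sup>+ r. ennreal (real n * unit_ball_vol n) *
      (ennreal ((sin (r * t))\<^sup>2 * r powr (real n - 2 - 2 * s - 1)) * indicator {0<..<\<delta>} r) \<partial>lborel)"
  proof (rule nn_integral_cong)
    fix r :: real
    show "ennreal (real n * unit_ball_vol n * r ^ (n - 1)) * indicator {0..} r * \<phi> r = ennreal (real n * unit_ball_vol n) *
      (ennreal ((sin (r * t))\<^sup>2 * r powr (real n - 2 - 2 * s - 1)) * indicator {0<..<\<delta>} r)"
    proof (cases "0 < r \<and> r < \<delta>")
      case True
      have "r ^ (n - 1) = r powr (real n - 1)"
        using True by (subst powr_realpow[symmetric]) (simp_all add: n_def of_nat_diff Suc_leI)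
      then have "r ^ (n - 1) * r powr (- 2 - 2 * s) = r powr (real n - 2 - 2 * s - 1)"
        by (simp add: powr_add[symmetric] algebra_simps)
      moreover have "real n * unit_ball_vol n * r ^ (n - 1) * ((sin (r * t))\<^sup>2 * r powr (- 2 - 2 * s))
          = real n * unit_ball_vol n * ((sin (r * t))\<^sup>2 * (r ^ (n - 1) * r powr (- 2 - 2 * s)))"
        by (simp only: mult_ac)
      ultimately have "real n * unit_ball_vol n * r ^ (n - 1) * ((sin (r * t))\<^sup>2 * r powr (- 2 - 2 * s))
          = real n * unit_ball_vol n * ((sin (r * t))\<^sup>2 * r powr (real n - 2 - 2 * s - 1))"
        by (simp only:)
      then show ?thesis
        using True by (simp add: \<phi>_def ennreal_mult'[symmetric])
    qed (cases "r = 0"; auto simp: \<phi>_def indicator_def)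
  qed
  also have "\<dots> = ennreal (real n * unit_ball_vol n) * sin_mass (real n - 2 - 2 * s) \<delta> t"
    unfolding sin_mass_def by (rule nn_integral_cmult) measurable
  finally show ?thesis .
qed

lemma D_square: "t \<ge> 1 \<Longrightarrow> (D n s t)\<^sup>2 = growth (real n - 2 - 2 * s) t"
proof -
  assume t: "t \<ge> 1"
  have "(t powr (1 + s - real n / 2))\<^sup>2 = t powr (2 + 2 * s - real n)"
    using t by (simp add: powr_power algebra_simps)
  then show ?thesis using t by (auto simp: D_def growth_def algebra_simps)
qed

text \<open>Division by |\<xi>|^s is possible off the origin, a null set; for h in L1 the transform
  is given by the integral.\<close>

lemma AE_fractional_gradient_L1:
  fixes F :: "'a::euclidean_space \<Rightarrow> complex"
  assumes "fractional_gradient s F h" "h \<in> L1"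
  shows "AE \<xi> in lebesgue. F \<xi> = of_real (norm \<xi> powr (- s)) * fourier_integral h \<xi>"
proof -
  have "AE \<xi> in lebesgue. of_real (norm \<xi> powr s) * F \<xi> = fourier_integral h \<xi>"
    using assms by (simp add: fractional_gradient_def fourier_transform_def)
  moreover have "AE \<xi> in lebesgue. \<xi> \<noteq> (0::'a)"
    by (intro AE_completion AE_lborel_singleton)
  ultimately show ?thesis
  proof eventually_elim
    case (elim \<xi>)
    have "norm \<xi> powr (- s) * norm \<xi> powr s = 1"
      using elim by (simp add: powr_minus)
    then have "F \<xi> = of_real (norm \<xi> powr (- s)) * (of_real (norm \<xi> powr s) * F \<xi>)"
      by (simp add: mult.assoc[symmetric] of_real_mult[symmetric] del: of_real_mult)
    then show ?case using elim by simp
  qed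
qed

text \<open>The free wave evolution in Fourier space, with position \<open>F\<close> and velocity
  \<open>G\<close>. The damping is only a scalar factor depending on t, which
  \<open>norm_v_square\<close> pulls out.\<close>

definition wave_hat :: "('a::euclidean_space \<Rightarrow> complex) \<Rightarrow> ('a \<Rightarrow> complex) \<Rightarrow> real \<Rightarrow> 'a \<Rightarrow> complex" where
  "wave_hat F G t \<xi> = of_real (cos (norm \<xi> * t)) * F \<xi> + of_real (sin (norm \<xi> * t) / norm \<xi>) * G \<xi>"

lemma wave_hat_measurable:
  fixes F G :: "'a::euclidean_space \<Rightarrow> complex"
  assumes [measurable]: "F \<in> borel_measurable lebesgue" "G \<in> borel_measurable lebesgue"
  shows "wave_hat F G t \<in> borel_measurable lebesgue"
proof -
  have [measurable]: "(\<lambda>\<xi>::'a. complex_of_real (cos (norm \<xi> * t))) \<in> borel_measurable lebesgue"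
    "(\<lambda>\<xi>::'a. complex_of_real (sin (norm \<xi> * t) / norm \<xi>)) \<in> borel_measurable lebesgue"
    by (rule measurable_completion, measurable)+
  show ?thesis unfolding wave_hat_def by measurable
qed

lemma norm_v_square:
  assumes "F0 \<in> borel_measurable lebesgue" "F1 \<in> borel_measurable lebesgue"
  shows "(norm_v \<tau> F0 F1 t)\<^sup>2 = ennreal (((1 + t) powr (- \<tau> / 2))\<^sup>2) * energy (wave_hat F0 (g_hat \<tau> F0 F1) t)"
proof -
  have "g_hat \<tau> F0 F1 \<in> borel_measurable lebesgue"
    unfolding g_hat_def using assms by measurable
  note wave_hat_measurable[OF assms(1) this, of t]
  then show ?thesis
    unfolding norm_v_def norm_L2_square v_hat_def wave_hat_def[symmetric] by (subst energy_cmult) simp_all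
qed

lemma cmod_wave_multiplier_square:
  "\<xi> \<noteq> 0 \<Longrightarrow> (cmod (of_real (sin (norm \<xi> * t) / norm \<xi>) * (of_real (norm \<xi> powr (- s)) * z)))\<^sup>2
     = (sin (norm \<xi> * t))\<^sup>2 * norm \<xi> powr (- 2 - 2 * s) * (cmod z)\<^sup>2"
proof -
  assume "\<xi> \<noteq> 0"
  then have r: "norm \<xi> > 0" by simp
  have "norm \<xi> powr (- 2 - 2 * s) = norm \<xi> powr (- 2) * norm \<xi> powr (- 2 * s)"
    by (simp add: powr_add[symmetric])
  also have "norm \<xi> powr (- 2) = 1 / (norm \<xi>)\<^sup>2" using r by (simp add: powr_minus_divide)
  also have "norm \<xi> powr (- 2 * s) = (norm \<xi> powr (- s))\<^sup>2" using r by (simp add: powr_power)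
  finally show ?thesis by (simp add: norm_mult norm_divide power_mult_distrib power_divide)
qed

text \<open>\<open>H\<close> stands for the transform of the fractional gradient of g, which makes
  the singular factor |\<xi>|^(-s) explicit. Outside the unit ball s \<ge> 0 bounds the squared
  symbol by 1, so the mass is needed only for radius 1.\<close>

lemma energy_wave_hat_upper:
  fixes F G H :: "'a::euclidean_space \<Rightarrow> complex" and s t :: real
  assumes [measurable]: "F \<in> borel_measurable lebesgue" and H [measurable]: "H \<in> borel_measurable lebesgue"
    and s: "s \<ge> 0" and G: "AE \<xi> in lebesgue. G \<xi> = of_real (norm \<xi> powr (- s)) * H \<xi>"
    and M: "\<And>\<xi>. cmod (H \<xi>) \<le> M"
  shows "energy (wave_hat F G t) \<le> 2 * energy F + 2 * energy H
    + ennreal (2 * M\<^sup>2 * (real DIM('a) * unit_ball_vol DIM('a))) * sin_mass (real DIM('a) - 2 - 2 * s) 1 t"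
proof -
  define \<phi> where "\<phi> \<xi> = ennreal ((sin (norm \<xi> * t))\<^sup>2 * norm \<xi> powr (- 2 - 2 * s)) * indicator (ball 0 1) \<xi>" for \<xi> :: 'a
  have [measurable]: "\<phi> \<in> borel_measurable lebesgue"
    unfolding \<phi>_def
    by (intro measurable_completion borel_measurable_times_ennreal borel_measurable_indicator) auto
  have "AE \<xi> in lebesgue. ennreal ((cmod (wave_hat F G t \<xi>))\<^sup>2)
      \<le> 2 * ennreal ((cmod (F \<xi>))\<^sup>2) + 2 * ennreal ((cmod (H \<xi>))\<^sup>2) + ennreal (2 * M\<^sup>2) * \<phi> \<xi>"
  proof -
    have "AE \<xi> in lebesgue. \<xi> \<noteq> (0::'a)"
      by (intro AE_completion AE_lborel_singleton)
    with G show ?thesis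
    proof eventually_elim
      case (elim \<xi>)
      define p where "p = (sin (norm \<xi> * t))\<^sup>2 * norm \<xi> powr (- 2 - 2 * s)"
      define i :: real where "i = indicator (ball 0 1) \<xi>"
      have p: "p \<ge> 0" by (simp add: p_def)
      have 1: "(cmod (wave_hat F G t \<xi>))\<^sup>2 \<le> 2 * (cmod (F \<xi>))\<^sup>2 + 2 * (p * (cmod (H \<xi>))\<^sup>2)"
      proof -
        have "(cmod (wave_hat F G t \<xi>))\<^sup>2 \<le> 2 * (cmod (of_real (cos (norm \<xi> * t)) * F \<xi>))\<^sup>2
            + 2 * (cmod (of_real (sin (norm \<xi> * t) / norm \<xi>) * G \<xi>))\<^sup>2"
          unfolding wave_hat_def by (rule cmod_add_square_le)
        also have "(cmod (of_real (sin (norm \<xi> * t) / norm \<xi>) * G \<xi>))\<^sup>2 = p * (cmod (H \<xi>))\<^sup>2"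
          unfolding elim(1) p_def by (rule cmod_wave_multiplier_square[OF elim(2)])
        also have "(cmod (of_real (cos (norm \<xi> * t)) * F \<xi>))\<^sup>2 \<le> (cmod (F \<xi>))\<^sup>2"
          by (intro power_mono) (simp_all add: norm_mult mult_left_le_one_le)
        finally show ?thesis by simp
      qed
      \<comment> \<open>The bounds for the two regions are added instead of splitting the integral:
        |H| \<le> M where |\<xi>| < 1, and p \<le> 1 elsewhere.\<close>
      have 2: "p * (cmod (H \<xi>))\<^sup>2 \<le> (cmod (H \<xi>))\<^sup>2 + M\<^sup>2 * (p * i)"
      proof (cases "norm \<xi> < 1")
        case True
        have "p * (cmod (H \<xi>))\<^sup>2 \<le> p * M\<^sup>2" using p M by (intro mult_left_mono power_mono) auto
        then show ?thesis using True by (simp add: i_def mult.commute add_increasing)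
      next
        case False
        have "norm \<xi> powr (- 2 - 2 * s) \<le> norm \<xi> powr 0" using False s by (intro powr_mono) auto
        then have "p \<le> 1 * 1"
          using elim unfolding p_def by (intro mult_mono) (auto simp: abs_square_le_1)
        then have "p * (cmod (H \<xi>))\<^sup>2 \<le> 1 * (cmod (H \<xi>))\<^sup>2" by (intro mult_right_mono) auto
        then show ?thesis using p by (simp add: i_def add_increasing2)
      qed
      have "(cmod (wave_hat F G t \<xi>))\<^sup>2 \<le> 2 * (cmod (F \<xi>))\<^sup>2 + 2 * (cmod (H \<xi>))\<^sup>2 + 2 * M\<^sup>2 * (p * i)"
        using 1 2 by simp
      then have "ennreal ((cmod (wave_hat F G t \<xi>))\<^sup>2)
          \<le> ennreal (2 * (cmod (F \<xi>))\<^sup>2 + 2 * (cmod (H \<xi>))\<^sup>2 + 2 * M\<^sup>2 * (p * i))"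
        by (rule ennreal_leI)
      also have "\<dots> = 2 * ennreal ((cmod (F \<xi>))\<^sup>2) + 2 * ennreal ((cmod (H \<xi>))\<^sup>2) + ennreal (2 * M\<^sup>2) * (ennreal p * ennreal i)"
        using p by (simp add: ennreal_mult i_def)
      also have "ennreal p * ennreal i = \<phi> \<xi>"
        by (simp add: \<phi>_def p_def i_def ennreal_indicator)
      finally show ?case .
    qed
  qed
  then have "energy (wave_hat F G t) \<le> (\<integral>\<^sup>+ \<xi>. 2 * ennreal ((cmod (F \<xi>))\<^sup>2) + 2 * ennreal ((cmod (H \<xi>))\<^sup>2)
      + ennreal (2 * M\<^sup>2) * \<phi> \<xi> \<partial>lebesgue)"
    unfolding energy_def by (rule nn_integral_mono_AE)
  also have "\<dots> = 2 * energy F + 2 * energy H + ennreal (2 * M\<^sup>2) * (\<integral>\<^sup>+ \<xi>. \<phi> \<xi> \<partial>lebesgue)"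
    unfolding energy_def by (simp add: nn_integral_add nn_integral_cmult)
  also have "(\<integral>\<^sup>+ \<xi>. \<phi> \<xi> \<partial>lebesgue) = ennreal (real DIM('a) * unit_ball_vol DIM('a)) * sin_mass (real DIM('a) - 2 - 2 * s) 1 t"
    unfolding \<phi>_def by (rule nn_integral_ball_sin_mass)
  also have "ennreal (2 * M\<^sup>2) * (ennreal (real DIM('a) * unit_ball_vol DIM('a)) * sin_mass (real DIM('a) - 2 - 2 * s) 1 t)
      = ennreal (2 * M\<^sup>2 * (real DIM('a) * unit_ball_vol DIM('a))) * sin_mass (real DIM('a) - 2 - 2 * s) 1 t"
    unfolding mult.assoc[symmetric] by (subst ennreal_mult'[symmetric]) (simp_all add: mult.assoc)
  finally show ?thesis .
qed

text \<open>The sine term is the solution minus the cosine term, whose modulus is at most |F|. Only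
  the part of F inside the ball is charged; if F is bounded this part is of order \<delta>^n and can
  be beaten, if F is in L2 it is finite.\<close>

lemma energy_wave_hat_lower:
  fixes F G H :: "'a::euclidean_space \<Rightarrow> complex" and s t :: real
  assumes [measurable]: "F \<in> borel_measurable lebesgue" "G \<in> borel_measurable lebesgue"
    and G: "AE \<xi> in lebesgue. G \<xi> = of_real (norm \<xi> powr (- s)) * H \<xi>"
    and k: "k \<ge> 0" and H: "\<And>\<xi>. norm \<xi> < \<delta> \<Longrightarrow> cmod (H \<xi>) \<ge> k"
  shows "ennreal (k\<^sup>2 * (real DIM('a) * unit_ball_vol DIM('a))) * sin_mass (real DIM('a) - 2 - 2 * s) \<delta> t
    \<le> 2 * energy (wave_hat F G t) + 2 * (\<integral>\<^sup>+ \<xi>. ennreal ((cmod (F \<xi>))\<^sup>2) * indicator (ball 0 \<delta>) \<xi> \<partial>lebesgue)"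
proof -
  define \<phi> where "\<phi> \<xi> = ennreal ((sin (norm \<xi> * t))\<^sup>2 * norm \<xi> powr (- 2 - 2 * s)) * indicator (ball 0 \<delta>) \<xi>" for \<xi> :: 'a
  have [measurable]: "\<phi> \<in> borel_measurable lebesgue"
    unfolding \<phi>_def
    by (intro measurable_completion borel_measurable_times_ennreal borel_measurable_indicator) auto
  have [measurable]: "wave_hat F G t \<in> borel_measurable lebesgue"
    by (rule wave_hat_measurable) measurable
  have [measurable]: "ball (0::'a) \<delta> \<in> sets lebesgue" by simp
  have AE: "AE \<xi> in lebesgue. ennreal (k\<^sup>2) * \<phi> \<xi>
      \<le> 2 * ennreal ((cmod (wave_hat F G t \<xi>))\<^sup>2) + 2 * (ennreal ((cmod (F \<xi>))\<^sup>2) * indicator (ball 0 \<delta>) \<xi>)"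
  proof -
    have "AE \<xi> in lebesgue. \<xi> \<noteq> (0::'a)"
      by (intro AE_completion AE_lborel_singleton)
    with G show ?thesis
    proof eventually_elim
      case (elim \<xi>)
      show ?case
      proof (cases "norm \<xi> < \<delta>")
        case True
        define p where "p = (sin (norm \<xi> * t))\<^sup>2 * norm \<xi> powr (- 2 - 2 * s)"
        have p: "p \<ge> 0" by (simp add: p_def)
        have "k\<^sup>2 * p \<le> (cmod (H \<xi>))\<^sup>2 * p"
          using p k H[OF True] by (intro mult_right_mono power_mono) auto
        also have "\<dots> = (cmod (of_real (sin (norm \<xi> * t) / norm \<xi>) * G \<xi>))\<^sup>2"
          unfolding elim(1) p_def cmod_wave_multiplier_square[OF elim(2)] by (simp add: mult.commute)
        also have "of_real (sin (norm \<xi> * t) / norm \<xi>) * G \<xi> = wave_hat F G t \<xi> + (- of_real (cos (norm \<xi> * t)) * F \<xi>)"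
          by (simp add: wave_hat_def)
        also have "(cmod \<dots>)\<^sup>2 \<le> 2 * (cmod (wave_hat F G t \<xi>))\<^sup>2 + 2 * (cmod (- of_real (cos (norm \<xi> * t)) * F \<xi>))\<^sup>2"
          by (rule cmod_add_square_le)
        also have "(cmod (- of_real (cos (norm \<xi> * t)) * F \<xi>))\<^sup>2 \<le> (cmod (F \<xi>))\<^sup>2"
          by (intro power_mono) (simp_all add: norm_mult mult_left_le_one_le)
        finally have "ennreal (k\<^sup>2 * p) \<le> ennreal (2 * (cmod (wave_hat F G t \<xi>))\<^sup>2 + 2 * (cmod (F \<xi>))\<^sup>2)"
          by (intro ennreal_leI) simp
        then show ?thesis using True p by (simp add: \<phi>_def p_def[symmetric] ennreal_mult)
      qed (simp add: \<phi>_def)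
    qed
  qed
  have "ennreal (k\<^sup>2 * (real DIM('a) * unit_ball_vol DIM('a))) * sin_mass (real DIM('a) - 2 - 2 * s) \<delta> t
      = ennreal (k\<^sup>2) * (\<integral>\<^sup>+ \<xi>. \<phi> \<xi> \<partial>lebesgue)"
    unfolding \<phi>_def nn_integral_ball_sin_mass by (simp add: ennreal_mult' mult.assoc)
  also have "\<dots> = (\<integral>\<^sup>+ \<xi>. ennreal (k\<^sup>2) * \<phi> \<xi> \<partial>lebesgue)"
    by (rule nn_integral_cmult[symmetric]) measurable
  also have "\<dots> \<le> (\<integral>\<^sup>+ \<xi>. 2 * ennreal ((cmod (wave_hat F G t \<xi>))\<^sup>2)
      + 2 * (ennreal ((cmod (F \<xi>))\<^sup>2) * indicator (ball 0 \<delta>) \<xi>) \<partial>lebesgue)"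
    by (rule nn_integral_mono_AE[OF AE])
  also have "\<dots> = 2 * energy (wave_hat F G t) + 2 * (\<integral>\<^sup>+ \<xi>. ennreal ((cmod (F \<xi>))\<^sup>2) * indicator (ball 0 \<delta>) \<xi> \<partial>lebesgue)"
    unfolding energy_def by (simp add: nn_integral_add nn_integral_cmult)
  finally show ?thesis .
qed

text \<open>The weight 1 + |x| makes the transform Lipschitz at the origin, by |exp(-i x.\<xi>) - 1|
  \<le> |x| |\<xi>|, and its value there is the normalising constant times the total mass.\<close>

lemma fourier_integral_lower_near_0:
  fixes f :: "'a::euclidean_space \<Rightarrow> complex"
  assumes f: "f \<in> L11" and P: "total_mass f \<noteq> 0"
  shows "\<exists>k>0. \<exists>\<delta>>0. \<forall>\<xi>. norm \<xi> < \<delta> \<longrightarrow> cmod (fourier_integral f \<xi>) \<ge> k"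
proof -
  define c where "c = (2 * pi) powr (- real DIM('a) / 2)"
  have c: "c > 0" by (simp add: c_def)
  have f1: "f \<in> L1" using f by (simp add: L11_def)
  note fi = L1_imp_integrable[OF f1]
  have [measurable]: "f \<in> borel_measurable lebesgue" using fi by simp
  have nx [measurable]: "(\<lambda>x::'a. complex_of_real (1 + norm x)) \<in> borel_measurable lebesgue"
    by (rule measurable_completion) measurable
  have wi: "integrable lebesgue (\<lambda>x. of_real (1 + norm x) * f x)"
  proof (rule integrableI_bounded)
    show "(\<lambda>x. of_real (1 + norm x) * f x) \<in> borel_measurable lebesgue" by measurable
    show "(\<integral>\<^sup>+ x. ennreal (cmod (of_real (1 + norm x) * f x)) \<partial>lebesgue) < \<infinity>"
      using f by (simp add: L11_def norm_L1_def)
  qed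
  define L where "L = (LINT x|lebesgue. cmod (of_real (1 + norm x) * f x))"
  have L: "L \<ge> 0" by (simp add: L_def)
  have nexp: "cmod (exp (- \<i> * of_real r)) = 1" for r
    by (simp add: norm_exp_eq_Re)
  have lip: "cmod (fourier_integral f \<xi> - of_real c * total_mass f) \<le> c * (norm \<xi> * L)" for \<xi>
  proof -
    have em [measurable]: "(\<lambda>x::'a. exp (- \<i> * of_real (x \<bullet> \<xi>))) \<in> borel_measurable lebesgue"
      by (rule measurable_completion) measurable
    have ei: "integrable lebesgue (\<lambda>x. exp (- \<i> * of_real (x \<bullet> \<xi>)) * f x)"
      by (rule Bochner_Integration.integrable_bound[OF fi], measurable) (simp add: norm_mult nexp)
    have "cmod ((LINT x|lebesgue. exp (- \<i> * of_real (x \<bullet> \<xi>)) * f x) - (LINT x|lebesgue. f x))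
        = cmod (LINT x|lebesgue. exp (- \<i> * of_real (x \<bullet> \<xi>)) * f x - f x)"
      using ei fi by simp
    also have "\<dots> \<le> (LINT x|lebesgue. norm \<xi> * cmod (of_real (1 + norm x) * f x))"
    proof (rule Bochner_Integration.integral_norm_bound_integral)
      show "integrable lebesgue (\<lambda>x. exp (- \<i> * of_real (x \<bullet> \<xi>)) * f x - f x)" using ei fi by simp
      show "integrable lebesgue (\<lambda>x. norm \<xi> * cmod (of_real (1 + norm x) * f x))"
        using integrable_norm[OF wi] by simp
      fix x :: 'a
      have "cmod (exp (- \<i> * of_real (x \<bullet> \<xi>)) * f x - f x) = cmod (exp (\<i> * of_real (- (x \<bullet> \<xi>))) - 1) * cmod (f x)"
        by (simp add: norm_mult[symmetric] algebra_simps)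
      also have "cmod (exp (\<i> * of_real (- (x \<bullet> \<xi>))) - 1) = 2 * \<bar>sin (- (x \<bullet> \<xi>) / 2)\<bar>"
        by (rule dist_exp_i_1)
      also have "\<dots> \<le> \<bar>x \<bullet> \<xi>\<bar>" using abs_sin_x_le_abs_x[of "- (x \<bullet> \<xi>) / 2"] by simp
      also have "\<dots> \<le> norm x * norm \<xi>" by (rule Cauchy_Schwarz_ineq2)
      also have "\<dots> \<le> norm \<xi> * (1 + norm x)" by (simp add: algebra_simps)
      finally show "cmod (exp (- \<i> * of_real (x \<bullet> \<xi>)) * f x - f x) \<le> norm \<xi> * cmod (of_real (1 + norm x) * f x)"
        by (simp add: norm_mult mult_right_mono mult.assoc[symmetric] del: of_real_add)
    qed
    also have "\<dots> = norm \<xi> * L" by (simp add: L_def)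
    finally have "c * cmod ((LINT x|lebesgue. exp (- \<i> * of_real (x \<bullet> \<xi>)) * f x) - (LINT x|lebesgue. f x)) \<le> c * (norm \<xi> * L)"
      using c by (intro mult_left_mono) auto
    moreover have "fourier_integral f \<xi> - of_real c * total_mass f
        = of_real c * ((LINT x|lebesgue. exp (- \<i> * of_real (x \<bullet> \<xi>)) * f x) - (LINT x|lebesgue. f x))"
      by (simp add: fourier_integral_def c_def total_mass_def algebra_simps)
    ultimately show ?thesis using c by (simp add: norm_mult)
  qed
  define P where "P = cmod (total_mass f)"
  have P: "P > 0" using assms(2) by (simp add: P_def)
  \<comment> \<open>Within this radius the transform deviates from its value at 0 by at most half of
    that value; L + 1 makes the denominator visibly positive.\<close>
  define \<delta> where "\<delta> = P / (2 * (L + 1))"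
  have \<delta>: "\<delta> > 0" using P L by (simp add: \<delta>_def)
  have "cmod (fourier_integral f \<xi>) \<ge> c * P / 2" if "norm \<xi> < \<delta>" for \<xi>
  proof -
    have "norm \<xi> * L \<le> \<delta> * (L + 1)" using that L \<delta> by (intro mult_mono) auto
    also have "\<dots> = P / 2" using L by (simp add: \<delta>_def field_simps)
    finally have "c * (norm \<xi> * L) \<le> c * (P / 2)" using c by (intro mult_left_mono) auto
    moreover have "cmod (of_real c * total_mass f) - cmod (fourier_integral f \<xi>)
        \<le> cmod (fourier_integral f \<xi> - of_real c * total_mass f)"
      by (metis norm_minus_commute norm_triangle_ineq2)
    moreover have "cmod (of_real c * total_mass f) = c * P" using c by (simp add: norm_mult P_def)
    ultimately show ?thesis using lip[of \<xi>] by linarith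
  qed
  moreover have "c * P / 2 > 0" using c P by simp
  ultimately show ?thesis using \<delta> by blast
qed

section \<open>Estimates for the solution\<close>

lemma fractional_gradient_measurable:
  "fractional_gradient s F h \<Longrightarrow> F \<in> borel_measurable lebesgue"
  by (simp add: fractional_gradient_def)

lemma unit_ball_mass_pos: "real DIM('a::euclidean_space) * unit_ball_vol DIM('a) > 0"
  by simp

text \<open>The transform of the fractional gradient of g is assembled from those of
  \<open>h0\<close> and \<open>h1\<close>, because the bound may only involve their norms. For t
  \<ge> exp 1 the growth is at least 1 and absorbs the energies that do not depend on t.\<close>

theorem norm_v_upper:
  fixes s \<tau> :: real
  assumes s: "s \<ge> 0" and n: "real DIM('a::euclidean_space) > 2 * s" and \<tau>: "\<tau> > 0"
  shows "\<exists>C>0. \<exists>T>0. \<forall>(v0 :: 'a \<Rightarrow> complex) F0 F1 h0 h1.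
         v0 \<in> L2 \<longrightarrow> fourier_transform v0 F0 \<longrightarrow>
         fractional_gradient s F0 h0 \<longrightarrow> h0 \<in> L2 \<inter> L1 \<longrightarrow>
         fractional_gradient s F1 h1 \<longrightarrow> h1 \<in> L2 \<inter> L1 \<longrightarrow>
         (\<forall>t\<ge>T. norm_v \<tau> F0 F1 t
            \<le> ennreal (C * t powr (- \<tau> / 2) * D DIM('a) s t) *
               (norm_L2 v0 + norm_L2_L1 h0 + norm_L2_L1 h1))"
proof -
  define q where "q = real DIM('a) - 2 - 2 * s"
  define K where "K = real DIM('a) * unit_ball_vol DIM('a)"
  have K: "K > 0" unfolding K_def by (rule unit_ball_mass_pos)
  obtain A where A: "A > 0" and sm: "\<And>t. t \<ge> exp 1 \<Longrightarrow> sin_mass q 1 t \<le> ennreal (A * growth q t)"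
    using sin_mass_upper[of q] n by (auto simp: q_def)
  \<comment> \<open>Each of the two transforms is bounded by the total data norm x, so |H| \<le>
    (\<tau>/2 + 1) x.\<close>
  define N where "N = \<tau> / 2 + 1"
  have N: "N \<ge> 0" using \<tau> by (simp add: N_def)
  \<comment> \<open>Twice the energy of \<open>F0\<close> is at most 4 x^2 and twice that of
    \<open>H\<close> at most (\<tau>^2 + 4) x^2, together 8 + \<tau>^2; the last summand is the
    low-frequency mass with M = N x.\<close>
  define B where "B = 8 + \<tau>\<^sup>2 + 2 * N\<^sup>2 * K * A"
  have B: "B > 0" unfolding B_def using K A by (intro add_pos_nonneg) auto
  have "norm_v \<tau> F0 F1 t \<le> ennreal (sqrt B * t powr (- \<tau> / 2) * D DIM('a) s t) *
      (norm_L2 v0 + norm_L2_L1 h0 + norm_L2_L1 h1)"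
    if v0: "v0 \<in> L2" "fourier_transform v0 F0"
      and h0: "fractional_gradient s F0 h0" "h0 \<in> L2 \<inter> L1"
      and h1: "fractional_gradient s F1 h1" "h1 \<in> L2 \<inter> L1"
      and t: "t \<ge> exp 1"
    for v0 :: "'a \<Rightarrow> complex" and F0 F1 h0 h1 t
  proof -
    define X where "X = norm_L2 v0 + norm_L2_L1 h0 + norm_L2_L1 h1"
    have "X < \<infinity>" using v0(1) h0(2) h1(2) by (simp add: X_def norm_L2_L1_def L1_def L2_def)
    then obtain x where x: "X = ennreal x" "x \<ge> 0" by (cases X) auto
    have e: "energy f \<le> ennreal (x\<^sup>2)" if "norm_L2 f \<le> X" for f :: "'a \<Rightarrow> complex"
    proof -
      have "energy f \<le> X\<^sup>2" unfolding norm_L2_square[symmetric] by (intro power_mono that) simp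
      then show ?thesis by (simp add: x ennreal_power)
    qed
    have le: "norm_L2 v0 \<le> X" "norm_L2 h0 \<le> X" "norm_L2 h1 \<le> X" "norm_L1 h0 \<le> X" "norm_L1 h1 \<le> X"
      unfolding X_def norm_L2_L1_def by (simp_all add: add_increasing add_increasing2)
    define H where "H \<xi> = of_real (\<tau> / 2) * fourier_integral h0 \<xi> + fourier_integral h1 \<xi>" for \<xi>
    have F0: "F0 \<in> borel_measurable lebesgue" and F1: "F1 \<in> borel_measurable lebesgue"
      using h0(1) h1(1) by (simp_all add: fractional_gradient_measurable)
    have m: "fourier_integral h0 \<in> borel_measurable lebesgue" "fourier_integral h1 \<in> borel_measurable lebesgue"
      using h0(2) h1(2) by (auto simp: L1_def intro!: measurable_completion fourier_integral_measurable)
    then have Hm: "H \<in> borel_measurable lebesgue" unfolding H_def by measurable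
    have "AE \<xi> in lebesgue. F0 \<xi> = of_real (norm \<xi> powr (- s)) * fourier_integral h0 \<xi>"
      "AE \<xi> in lebesgue. F1 \<xi> = of_real (norm \<xi> powr (- s)) * fourier_integral h1 \<xi>"
      using AE_fractional_gradient_L1[OF h0(1)] AE_fractional_gradient_L1[OF h1(1)] h0(2) h1(2) by auto
    then have G: "AE \<xi> in lebesgue. g_hat \<tau> F0 F1 \<xi> = of_real (norm \<xi> powr (- s)) * H \<xi>"
      by eventually_elim (simp add: g_hat_def H_def algebra_simps)
    have HN: "cmod (H \<xi>) \<le> N * x" for \<xi>
    proof -
      have "cmod (fourier_integral h0 \<xi>) \<le> x" "cmod (fourier_integral h1 \<xi>) \<le> x"
        using cmod_fourier_integral_le[of h0 \<xi>] cmod_fourier_integral_le[of h1 \<xi>] h0(2) h1(2) le(4,5) x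
        by (auto dest: order_trans)
      then have "\<tau> / 2 * cmod (fourier_integral h0 \<xi>) + cmod (fourier_integral h1 \<xi>) \<le> \<tau> / 2 * x + x"
        using \<tau> by (intro add_mono mult_left_mono) auto
      moreover have "cmod (H \<xi>) \<le> \<tau> / 2 * cmod (fourier_integral h0 \<xi>) + cmod (fourier_integral h1 \<xi>)"
        unfolding H_def using \<tau> by (intro order_trans[OF norm_triangle_ineq]) (simp add: norm_mult)
      ultimately show ?thesis by (simp add: N_def algebra_simps)
    qed
    have eF: "energy F0 \<le> ennreal (2 * x\<^sup>2)"
    proof -
      have "energy F0 \<le> 2 * energy v0" by (rule energy_fourier_transform_le[OF v0])
      also have "\<dots> \<le> 2 * ennreal (x\<^sup>2)" by (intro mult_left_mono e le) simp
      finally show ?thesis by (simp add: ennreal_mult)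
    qed
    have eH: "energy H \<le> ennreal (\<tau>\<^sup>2 / 2 * x\<^sup>2 + 2 * x\<^sup>2)"
    proof -
      have eh: "energy (fourier_integral h0) \<le> ennreal (x\<^sup>2)" "energy (fourier_integral h1) \<le> ennreal (x\<^sup>2)"
        using energy_fourier_integral_le[of h0] energy_fourier_integral_le[of h1] h0(2) h1(2) e le(2,3)
        by (auto dest: order_trans)
      have "energy H \<le> 2 * energy (\<lambda>\<xi>. of_real (\<tau> / 2) * fourier_integral h0 \<xi>) + 2 * energy (fourier_integral h1)"
        unfolding H_def using m by (intro energy_add_le) measurable
      also have "energy (\<lambda>\<xi>. of_real (\<tau> / 2) * fourier_integral h0 \<xi>)
          = ennreal ((cmod (of_real (\<tau> / 2)))\<^sup>2) * energy (fourier_integral h0)"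
        by (rule energy_cmult[OF m(1)])
      also have "2 * (ennreal ((cmod (of_real (\<tau> / 2)))\<^sup>2) * energy (fourier_integral h0)) + 2 * energy (fourier_integral h1)
          \<le> 2 * (ennreal ((cmod (of_real (\<tau> / 2)))\<^sup>2) * ennreal (x\<^sup>2)) + 2 * ennreal (x\<^sup>2)"
        by (intro add_mono mult_left_mono eh) auto
      also have "\<dots> = ennreal (2 * ((\<tau> / 2)\<^sup>2 * x\<^sup>2) + 2 * x\<^sup>2)"
        using \<tau> by (simp add: ennreal_mult)
      also have "2 * ((\<tau> / 2)\<^sup>2 * x\<^sup>2) = \<tau>\<^sup>2 / 2 * x\<^sup>2" by (simp add: power_divide)
      finally show ?thesis .
    qed
    have gr: "growth q t \<ge> 1" by (rule growth_ge_1[OF t])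
    have t1: "t \<ge> 1" using t one_le_exp_iff[of 1] by linarith
    have "energy (wave_hat F0 (g_hat \<tau> F0 F1) t) \<le> 2 * energy F0 + 2 * energy H
        + ennreal (2 * (N * x)\<^sup>2 * K) * sin_mass q 1 t"
      unfolding K_def q_def by (rule energy_wave_hat_upper[OF F0 Hm s G HN])
    also have "\<dots> \<le> 2 * ennreal (2 * x\<^sup>2) + 2 * ennreal (\<tau>\<^sup>2 / 2 * x\<^sup>2 + 2 * x\<^sup>2)
        + ennreal (2 * (N * x)\<^sup>2 * K) * ennreal (A * growth q t)"
      by (intro add_mono mult_left_mono eF eH sm t) auto
    also have "\<dots> = ennreal (2 * (2 * x\<^sup>2)) + ennreal (2 * (\<tau>\<^sup>2 / 2 * x\<^sup>2 + 2 * x\<^sup>2))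
        + ennreal (2 * (N * x)\<^sup>2 * K * (A * growth q t))"
      using K A gr by (simp only: ennreal_mult ennreal_numeral zero_le_power2 mult_nonneg_nonneg
          add_nonneg_nonneg divide_nonneg_nonneg zero_le_numeral less_imp_le order_trans[OF zero_le_one])
    also have "\<dots> = ennreal (2 * (2 * x\<^sup>2) + 2 * (\<tau>\<^sup>2 / 2 * x\<^sup>2 + 2 * x\<^sup>2) + 2 * (N * x)\<^sup>2 * K * (A * growth q t))"
    proof -
      have "ennreal a + ennreal b + ennreal c = ennreal (a + b + c)" if "a \<ge> 0" "b \<ge> 0" "c \<ge> 0" for a b c
        using that by simp
      note plus3 = this
      show ?thesis by (rule plus3) (use K A gr in auto)
    qed
    also have "\<dots> \<le> ennreal (B * growth q t * x\<^sup>2)"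
    proof (rule ennreal_leI)
      have "(8 + \<tau>\<^sup>2) * x\<^sup>2 * 1 \<le> (8 + \<tau>\<^sup>2) * x\<^sup>2 * growth q t"
        using gr by (intro mult_left_mono) auto
      then show "2 * (2 * x\<^sup>2) + 2 * (\<tau>\<^sup>2 / 2 * x\<^sup>2 + 2 * x\<^sup>2) + 2 * (N * x)\<^sup>2 * K * (A * growth q t)
          \<le> B * growth q t * x\<^sup>2"
        by (simp add: B_def power_mult_distrib algebra_simps)
    qed
    finally have E: "energy (wave_hat F0 (g_hat \<tau> F0 F1) t) \<le> ennreal (B * growth q t * x\<^sup>2)" .
    have "(norm_v \<tau> F0 F1 t)\<^sup>2 \<le> ennreal (((1 + t) powr (- \<tau> / 2))\<^sup>2) * ennreal (B * growth q t * x\<^sup>2)"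
      unfolding norm_v_square[OF F0 F1] by (intro mult_left_mono E) simp
    also have "\<dots> = ennreal (((1 + t) powr (- \<tau> / 2))\<^sup>2 * (B * growth q t * x\<^sup>2))"
      by (rule ennreal_mult'[symmetric]) simp
    also have "\<dots> \<le> ennreal ((t powr (- \<tau> / 2))\<^sup>2 * (B * growth q t * x\<^sup>2))"
    proof (intro ennreal_leI mult_right_mono power_mono)
      show "(1 + t) powr (- \<tau> / 2) \<le> t powr (- \<tau> / 2)" using \<tau> t1 by (intro powr_mono2') auto
      show "0 \<le> B * growth q t * x\<^sup>2" using B gr by simp
    qed simp
    also have "(t powr (- \<tau> / 2))\<^sup>2 * (B * growth q t * x\<^sup>2) = (sqrt B * t powr (- \<tau> / 2) * D DIM('a) s t * x)\<^sup>2"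
      using B D_square[OF t1, of "DIM('a)" s] by (simp add: power_mult_distrib q_def)
    also have "ennreal \<dots> = (ennreal (sqrt B * t powr (- \<tau> / 2) * D DIM('a) s t) * X)\<^sup>2"
    proof -
      have "D DIM('a) s t \<ge> 0" using t1 by (simp add: D_def)
      then have "0 \<le> sqrt B * t powr (- \<tau> / 2) * D DIM('a) s t" using B by simp
      then show ?thesis using x by (simp only: x ennreal_mult[symmetric] ennreal_power mult_nonneg_nonneg)
    qed
    finally show ?thesis unfolding X_def by (rule ennreal_square_le_imp_le)
  qed
  then show ?thesis using B by (intro exI[of _ "sqrt B"] conjI exI[of _ "exp 1"]) auto
qed

theorem norm_v_lower:
  fixes s \<tau> :: real and v0 :: "'a::euclidean_space \<Rightarrow> complex"
  assumes n: "real DIM('a) > 2 * s" and "s \<ge> 0" and \<tau>: "\<tau> > 0"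
    and v0: "v0 \<in> L1" "fourier_transform v0 F0" and F1: "F1 \<in> borel_measurable lebesgue"
    and g: "fractional_gradient s (g_hat \<tau> F0 F1) hg" "hg \<in> L11" "total_mass hg \<noteq> 0"
  shows "\<exists>c>0. \<exists>T>0. \<forall>t\<ge>T.
      ennreal (c * t powr (- \<tau> / 2) * D DIM('a) s t * cmod (total_mass hg)) \<le> norm_v \<tau> F0 F1 t"
proof -
  define q where "q = real DIM('a) - 2 - 2 * s"
  define K where "K = real DIM('a) * unit_ball_vol DIM('a)"
  have K: "K > 0" unfolding K_def by (rule unit_ball_mass_pos)
  have F0: "F0 \<in> borel_measurable lebesgue" using v0(2) by (simp add: fourier_transform_def)
  have G: "g_hat \<tau> F0 F1 \<in> borel_measurable lebesgue" by (rule fractional_gradient_measurable[OF g(1)])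
  have hg1: "hg \<in> L1" using g(2) by (simp add: L11_def)
  obtain k \<delta>0 where k: "k > 0" and \<delta>0: "\<delta>0 > 0"
    and low: "\<And>\<xi>. norm \<xi> < \<delta>0 \<Longrightarrow> k \<le> cmod (fourier_integral hg \<xi>)"
    using fourier_integral_lower_near_0[OF g(2,3)] by blast
  define m where "m = enn2real (norm_L1 v0)"
  have m: "norm_L1 v0 = ennreal m" "m \<ge> 0" using v0(1) by (simp_all add: m_def L1_def)
  \<comment> \<open>The transform of \<open>v0\<close> is bounded by \<open>m\<close>, so B
    \<delta>^n bounds twice its energy on the ball of radius \<delta>.\<close>
  define B where "B = 2 * m\<^sup>2 * unit_ball_vol DIM('a)"
  have B: "B \<ge> 0" by (simp add: B_def)
  obtain \<delta> c where \<delta>: "\<delta> > 0" "\<delta> \<le> \<delta>0" and c: "c > 0"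
    and ev: "eventually (\<lambda>t. ennreal (c * growth q t + B * \<delta> powr DIM('a)) \<le> ennreal (k\<^sup>2 * K) * sin_mass q \<delta> t) at_top"
    using sin_mass_dominates[of q "real DIM('a)" "k\<^sup>2 * K" B \<delta>0] k K B \<delta>0 \<open>s \<ge> 0\<close> by (auto simp: q_def)
  have F0_ball: "2 * (\<integral>\<^sup>+ \<xi>. ennreal ((cmod (F0 \<xi>))\<^sup>2) * indicator (ball 0 \<delta>) \<xi> \<partial>lebesgue) \<le> ennreal (B * \<delta> powr DIM('a))"
  proof -
    have "AE \<xi> in lebesgue. F0 \<xi> = fourier_integral v0 \<xi>"
      using v0 by (simp add: fourier_transform_def)
    then have "AE \<xi> in lebesgue. ennreal ((cmod (F0 \<xi>))\<^sup>2) * indicator (ball 0 \<delta>) \<xi> \<le> ennreal (m\<^sup>2) * indicator (ball 0 \<delta>) \<xi>"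
    proof eventually_elim
      case (elim \<xi>)
      have "cmod (F0 \<xi>) \<le> m"
        using cmod_fourier_integral_le[OF v0(1), of \<xi>] m by (simp add: elim)
      then show ?case by (intro mult_right_mono ennreal_leI power_mono) auto
    qed
    then have "(\<integral>\<^sup>+ \<xi>. ennreal ((cmod (F0 \<xi>))\<^sup>2) * indicator (ball 0 \<delta>) \<xi> \<partial>lebesgue)
        \<le> (\<integral>\<^sup>+ \<xi>. ennreal (m\<^sup>2) * indicator (ball (0::'a) \<delta>) \<xi> \<partial>lebesgue)"
      by (rule nn_integral_mono_AE)
    also have "\<dots> = ennreal (m\<^sup>2) * ennreal (unit_ball_vol DIM('a) * \<delta> ^ DIM('a))"
      using \<delta> by (subst nn_integral_cmult_indicator) (simp_all add: emeasure_ball)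
    also have "\<dots> = ennreal (m\<^sup>2 * (unit_ball_vol DIM('a) * \<delta> ^ DIM('a)))"
      by (rule ennreal_mult'[symmetric]) simp
    finally have "2 * (\<integral>\<^sup>+ \<xi>. ennreal ((cmod (F0 \<xi>))\<^sup>2) * indicator (ball 0 \<delta>) \<xi> \<partial>lebesgue)
        \<le> 2 * ennreal (m\<^sup>2 * (unit_ball_vol DIM('a) * \<delta> ^ DIM('a)))"
      by (rule mult_left_mono) simp
    also have "\<dots> = ennreal (2 * (m\<^sup>2 * (unit_ball_vol DIM('a) * \<delta> ^ DIM('a))))"
      using \<delta> by (subst ennreal_mult) simp_all
    also have "2 * (m\<^sup>2 * (unit_ball_vol DIM('a) * \<delta> ^ DIM('a))) = B * \<delta> powr DIM('a)"
      using \<delta> by (simp add: B_def powr_realpow)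
    finally show ?thesis .
  qed
  define P where "P = cmod (total_mass hg)"
  have P: "P > 0" using g(3) by (simp add: P_def)
  \<comment> \<open>The factor 2^(-\<tau>/2) comes from 1 + t \<le> 2t, sqrt (c / 2) from the lower
    bound for the energy, and 1 / P cancels the factor |P| in the claim, which is allowed as the
    constant may depend on the data.\<close>
  define c' where "c' = 2 powr (- \<tau> / 2) * sqrt (c / 2) / P"
  have c': "c' > 0" using c P by (simp add: c'_def)
  have "eventually (\<lambda>t. ennreal (c' * t powr (- \<tau> / 2) * D DIM('a) s t * P) \<le> norm_v \<tau> F0 F1 t) at_top"
    using ev eventually_ge_at_top[of 1]
  proof eventually_elim
    case (elim t)
    define E where "E = energy (wave_hat F0 (g_hat \<tau> F0 F1) t)"
    have gr: "growth q t \<ge> 0" using elim by (intro growth_nonneg)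
    have "ennreal (c * growth q t) + ennreal (B * \<delta> powr DIM('a)) = ennreal (c * growth q t + B * \<delta> powr DIM('a))"
      using c gr B by (intro ennreal_plus[symmetric]) auto
    also have "\<dots> \<le> ennreal (k\<^sup>2 * K) * sin_mass q \<delta> t" by (rule elim)
    also have "\<dots> \<le> 2 * E + 2 * (\<integral>\<^sup>+ \<xi>. ennreal ((cmod (F0 \<xi>))\<^sup>2) * indicator (ball 0 \<delta>) \<xi> \<partial>lebesgue)"
      unfolding K_def q_def E_def
      using k \<delta> low by (intro energy_wave_hat_lower[OF F0 G AE_fractional_gradient_L1[OF g(1) hg1]]) auto
    also have "\<dots> \<le> 2 * E + ennreal (B * \<delta> powr DIM('a))"
      using F0_ball by (rule add_left_mono)
    finally have "ennreal (B * \<delta> powr DIM('a)) + ennreal (c * growth q t) \<le> ennreal (B * \<delta> powr DIM('a)) + 2 * E"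
      by (simp only: add.commute)
    \<comment> \<open>The volume term is finite, so it may be cancelled in [0, \<infinity>].\<close>
    then have "ennreal (c * growth q t) \<le> 2 * E"
      by (simp only: ennreal_add_left_cancel_le) simp
    then have "ennreal (c * growth q t / 2) \<le> E" by (rule ennreal_le_two_mult_imp)
    then have ge: "ennreal (((1 + t) powr (- \<tau> / 2))\<^sup>2) * ennreal (c * growth q t / 2) \<le> (norm_v \<tau> F0 F1 t)\<^sup>2"
      unfolding norm_v_square[OF F0 F1] E_def by (rule mult_left_mono) simp
    have "(ennreal (c' * t powr (- \<tau> / 2) * D DIM('a) s t * P))\<^sup>2
        \<le> ennreal (((1 + t) powr (- \<tau> / 2))\<^sup>2) * ennreal (c * growth q t / 2)"
    proof -
      have Dn: "D DIM('a) s t \<ge> 0" using elim by (simp add: D_def)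
      have "2 powr (- \<tau> / 2) * t powr (- \<tau> / 2) = (2 * t) powr (- \<tau> / 2)"
        using elim by (simp add: powr_mult)
      also have "\<dots> \<le> (1 + t) powr (- \<tau> / 2)"
        using \<tau> elim by (intro powr_mono2') auto
      finally have p: "2 powr (- \<tau> / 2) * t powr (- \<tau> / 2) \<le> (1 + t) powr (- \<tau> / 2)" .
      have "(c' * t powr (- \<tau> / 2) * D DIM('a) s t * P)\<^sup>2
          = (2 powr (- \<tau> / 2) * t powr (- \<tau> / 2))\<^sup>2 * (c / 2 * (D DIM('a) s t)\<^sup>2)"
        using P c by (simp add: c'_def power_mult_distrib power_divide)
      also have "\<dots> \<le> ((1 + t) powr (- \<tau> / 2))\<^sup>2 * (c / 2 * (D DIM('a) s t)\<^sup>2)"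
        using c p by (intro mult_right_mono power_mono) auto
      also have "(D DIM('a) s t)\<^sup>2 = growth q t"
        using D_square[OF elim(2), of "DIM('a)" s] by (simp add: q_def)
      finally have "ennreal ((c' * t powr (- \<tau> / 2) * D DIM('a) s t * P)\<^sup>2)
          \<le> ennreal (((1 + t) powr (- \<tau> / 2))\<^sup>2 * (c * growth q t / 2))"
        by (intro ennreal_leI) simp
      also have "\<dots> = ennreal (((1 + t) powr (- \<tau> / 2))\<^sup>2) * ennreal (c * growth q t / 2)"
        by (rule ennreal_mult') simp
      finally show ?thesis
        using c' P Dn by (subst ennreal_power) auto
    qed
    from order_trans[OF this ge] show ?case by (rule ennreal_square_le_imp_le)
  qed
  then obtain T where T: "\<And>t. t \<ge> T \<Longrightarrow> ennreal (c' * t powr (- \<tau> / 2) * D DIM('a) s t * P) \<le> norm_v \<tau> F0 F1 t"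
    unfolding eventually_at_top_linorder by blast
  show ?thesis
    using c' T unfolding P_def by (intro exI[of _ c'] conjI exI[of _ "max 1 T"]) auto
qed

text \<open>On a small ball the sine term alone has infinite energy for each t > 0, while the cosine
  term has finite energy because v0 is in L2. So the solution has infinite energy, and the positive
  damping factor cannot change that.\<close>

theorem norm_v_infinite:
  fixes s \<tau> t :: real and v0 :: "'a::euclidean_space \<Rightarrow> complex"
  assumes n: "real DIM('a) \<le> 2 * s" and t: "t > 0"
    and v0: "v0 \<in> L2" "fourier_transform v0 F0" and F1: "F1 \<in> borel_measurable lebesgue"
    and g: "fractional_gradient s (g_hat \<tau> F0 F1) hg" "hg \<in> L11" "total_mass hg \<noteq> 0"
  shows "norm_v \<tau> F0 F1 t = \<infinity>"
proof -
  define K where "K = real DIM('a) * unit_ball_vol DIM('a)"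
  have K: "K > 0" unfolding K_def by (rule unit_ball_mass_pos)
  have F0: "F0 \<in> borel_measurable lebesgue" using v0(2) by (simp add: fourier_transform_def)
  have G: "g_hat \<tau> F0 F1 \<in> borel_measurable lebesgue" by (rule fractional_gradient_measurable[OF g(1)])
  have hg1: "hg \<in> L1" using g(2) by (simp add: L11_def)
  obtain k \<delta> where k: "k > 0" and \<delta>: "\<delta> > 0"
    and low: "\<And>\<xi>. norm \<xi> < \<delta> \<Longrightarrow> k \<le> cmod (fourier_integral hg \<xi>)"
    using fourier_integral_lower_near_0[OF g(2,3)] by blast
  have "sin_mass (real DIM('a) - 2 - 2 * s) \<delta> t = \<infinity>"
    using n \<delta> t by (intro sin_mass_infinite) auto
  then have "\<infinity> = ennreal (k\<^sup>2 * K) * sin_mass (real DIM('a) - 2 - 2 * s) \<delta> t"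
    using k K by (simp add: ennreal_mult_top)
  also have "\<dots> \<le> 2 * energy (wave_hat F0 (g_hat \<tau> F0 F1) t)
      + 2 * (\<integral>\<^sup>+ \<xi>. ennreal ((cmod (F0 \<xi>))\<^sup>2) * indicator (ball 0 \<delta>) \<xi> \<partial>lebesgue)"
    unfolding K_def
    using k \<delta> low by (intro energy_wave_hat_lower[OF F0 G AE_fractional_gradient_L1[OF g(1) hg1]]) auto
  also have "(\<integral>\<^sup>+ \<xi>. ennreal ((cmod (F0 \<xi>))\<^sup>2) * indicator (ball 0 \<delta>) \<xi> \<partial>lebesgue) \<le> energy F0"
    unfolding energy_def by (intro nn_integral_mono) (simp add: indicator_def)
  finally have *: "2 * energy (wave_hat F0 (g_hat \<tau> F0 F1) t) + 2 * energy F0 = \<infinity>"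
    by (simp add: add_left_mono mult_left_mono top_unique)
  have "energy F0 \<le> 2 * energy v0" by (rule energy_fourier_transform_le[OF v0])
  also have "\<dots> < \<infinity>" using L2_energy_finite[OF v0(1)] by (simp add: ennreal_mult_less_top)
  finally have "energy (wave_hat F0 (g_hat \<tau> F0 F1) t) = \<infinity>"
    using * by (auto simp: ennreal_mult_eq_top_iff)
  then have "(norm_v \<tau> F0 F1 t)\<^sup>2 = \<infinity>"
    unfolding norm_v_square[OF F0 F1] using t by (simp add: ennreal_mult_top)
  then show ?thesis by (simp add: power2_eq_square ennreal_mult_eq_top_iff)
qed

theorem mainTheorem5:
  fixes s \<tau>1 :: real
  assumes "s \<ge> 0" and "\<tau>1 > 0"
  shows
    "(real CARD('n) > 2 * s \<longrightarrow>
       (\<exists>C>0. \<exists>T>0. \<forall>(v0 :: real ^ 'n::finite \<Rightarrow> complex) F0 F1 h0 h1.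
         v0 \<in> L2 \<longrightarrow> fourier_transform v0 F0 \<longrightarrow>
         fractional_gradient s F0 h0 \<longrightarrow> h0 \<in> L2 \<inter> L1 \<longrightarrow>
         fractional_gradient s F1 h1 \<longrightarrow> h1 \<in> L2 \<inter> L1 \<longrightarrow>
         (\<forall>t\<ge>T. norm_v \<tau>1 F0 F1 t
            \<le> ennreal (C * t powr (- \<tau>1 / 2) * D CARD('n) s t) *
               (norm_L2 v0 + norm_L2_L1 h0 + norm_L2_L1 h1)))) \<and>
     (real CARD('n) > 2 * s \<longrightarrow>
       (\<forall>(v0 :: real ^ 'n \<Rightarrow> complex) F0 F1 h0 h1 hg.
         v0 \<in> L2 \<inter> L1 \<longrightarrow> fourier_transform v0 F0 \<longrightarrow>
         fractional_gradient s F0 h0 \<longrightarrow> h0 \<in> L2 \<inter> L1 \<longrightarrow>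
         fractional_gradient s F1 h1 \<longrightarrow> h1 \<in> L2 \<inter> L1 \<longrightarrow>
         fractional_gradient s (g_hat \<tau>1 F0 F1) hg \<longrightarrow> hg \<in> L11 \<longrightarrow>
         total_mass hg \<noteq> 0 \<longrightarrow>
         (\<exists>c>0. \<exists>T>0. \<forall>t\<ge>T.
            ennreal (c * t powr (- \<tau>1 / 2) * D CARD('n) s t * cmod (total_mass hg))
              \<le> norm_v \<tau>1 F0 F1 t))) \<and>
     (real CARD('n) \<le> 2 * s \<longrightarrow>
       (\<forall>(v0 :: real ^ 'n \<Rightarrow> complex) F0 F1 hg.
         v0 \<in> L2 \<longrightarrow> fourier_transform v0 F0 \<longrightarrow> F1 \<in> borel_measurable lebesgue \<longrightarrow>
         fractional_gradient s (g_hat \<tau>1 F0 F1) hg \<longrightarrow> hg \<in> L11 \<longrightarrow>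
         total_mass hg \<noteq> 0 \<longrightarrow>
         (\<forall>t0>0. \<forall>t\<in>{0<..t0}. norm_v \<tau>1 F0 F1 t = \<infinity>)))"
proof (intro conjI impI)
  have dim: "DIM(real ^ 'n) = CARD('n)" by simp
  show "\<exists>C>0. \<exists>T>0. \<forall>(v0 :: real ^ 'n \<Rightarrow> complex) F0 F1 h0 h1.
         v0 \<in> L2 \<longrightarrow> fourier_transform v0 F0 \<longrightarrow>
         fractional_gradient s F0 h0 \<longrightarrow> h0 \<in> L2 \<inter> L1 \<longrightarrow>
         fractional_gradient s F1 h1 \<longrightarrow> h1 \<in> L2 \<inter> L1 \<longrightarrow>
         (\<forall>t\<ge>T. norm_v \<tau>1 F0 F1 t
            \<le> ennreal (C * t powr (- \<tau>1 / 2) * D CARD('n) s t) *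
               (norm_L2 v0 + norm_L2_L1 h0 + norm_L2_L1 h1))"
    if "real CARD('n) > 2 * s"
    using norm_v_upper[where 'a="real ^ 'n", unfolded dim] assms that by blast
  show "\<forall>(v0 :: real ^ 'n \<Rightarrow> complex) F0 F1 h0 h1 hg.
         v0 \<in> L2 \<inter> L1 \<longrightarrow> fourier_transform v0 F0 \<longrightarrow>
         fractional_gradient s F0 h0 \<longrightarrow> h0 \<in> L2 \<inter> L1 \<longrightarrow>
         fractional_gradient s F1 h1 \<longrightarrow> h1 \<in> L2 \<inter> L1 \<longrightarrow>
         fractional_gradient s (g_hat \<tau>1 F0 F1) hg \<longrightarrow> hg \<in> L11 \<longrightarrow>
         total_mass hg \<noteq> 0 \<longrightarrow>
         (\<exists>c>0. \<exists>T>0. \<forall>t\<ge>T.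
            ennreal (c * t powr (- \<tau>1 / 2) * D CARD('n) s t * cmod (total_mass hg))
              \<le> norm_v \<tau>1 F0 F1 t)"
    if "real CARD('n) > 2 * s"
  proof (intro allI impI)
    fix v0 :: "real ^ 'n \<Rightarrow> complex" and F0 F1 h0 h1 hg
    assume v0: "v0 \<in> L2 \<inter> L1" "fourier_transform v0 F0" and h1: "fractional_gradient s F1 h1"
      and g: "fractional_gradient s (g_hat \<tau>1 F0 F1) hg" "hg \<in> L11" "total_mass hg \<noteq> 0"
    from v0(1) have "v0 \<in> L1" by simp
    then show "\<exists>c>0. \<exists>T>0. \<forall>t\<ge>T.
            ennreal (c * t powr (- \<tau>1 / 2) * D CARD('n) s t * cmod (total_mass hg))
              \<le> norm_v \<tau>1 F0 F1 t"
      using norm_v_lower[where 'a="real ^ 'n", unfolded dim, OF that assms _ v0(2)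
          fractional_gradient_measurable[OF h1] g] by blast
  qed
  show "\<forall>(v0 :: real ^ 'n \<Rightarrow> complex) F0 F1 hg.
         v0 \<in> L2 \<longrightarrow> fourier_transform v0 F0 \<longrightarrow> F1 \<in> borel_measurable lebesgue \<longrightarrow>
         fractional_gradient s (g_hat \<tau>1 F0 F1) hg \<longrightarrow> hg \<in> L11 \<longrightarrow>
         total_mass hg \<noteq> 0 \<longrightarrow>
         (\<forall>t0>0. \<forall>t\<in>{0<..t0}. norm_v \<tau>1 F0 F1 t = \<infinity>)"
    if "real CARD('n) \<le> 2 * s"
    using norm_v_infinite[where 'a="real ^ 'n", unfolded dim, OF that] by auto
qed

end
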